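(* Let $M$ be a complete Riemannian manifold with Riemannian distance $d$, and let $f:M\to\mathbb R$ be a function of class $C^1$ such that $\inf_M f>-\infty$. Then, for every sequence $(x_n)$ in $M$ such that $f(x_n)\to\inf_M f$, there exists a sequence $(y_n)$ in $M$ such that $d(x_n,y_n)\to 0$, $f(y_n)\to\inf_M f$ and $\|\nabla f(y_n)\|\to 0$.
   Context: "Complete manifold" means complete (connected, boundaryless) Riemannian manifold. $\nabla f$ is the Riemannian gradient of $f$. *)

theory Defs
  imports "HOL-Analysis.Analysis"
begin

section \<open>Functions of class C^k\<close>

text \<open>On an open subset of a finite-dimensional space this is the usual notion: total
  differentiability together with all directional derivatives being of class \<open>C^(k-1)\<close>.\<close>

primrec Ck_on :: "nat \<Rightarrow> ('a::real_normed_vector \<Rightarrow> 'b::real_normed_vector) \<Rightarrow> 'a set \<Rightarrow> bool" where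
  "Ck_on 0 h S \<longleftrightarrow> continuous_on S h"
| "Ck_on (Suc k) h S \<longleftrightarrow> (\<forall>x\<in>S. h differentiable (at x)) \<and>
     (\<forall>v. Ck_on k (\<lambda>x. frechet_derivative h (at x) v) S)"

definition smooth_on :: "('a::real_normed_vector \<Rightarrow> 'b::real_normed_vector) \<Rightarrow> 'a set \<Rightarrow> bool" where
  "smooth_on h S \<longleftrightarrow> (\<forall>k. Ck_on k h S)"


section \<open>Charts and atlases\<close>

text \<open>A manifold is a type \<open>'m\<close> of class \<^class>\<open>t2_space\<close> and
  \<^class>\<open>second_countable_topology\<close> together with a smooth atlas \<open>A\<close>. Any atlas is admitted, not
  only maximal ones. A chart consists of its domain and its coordinate map; the values of the
  coordinate map outside the domain are irrelevant.\<close>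

type_synonym ('m, 'e) chart = "'m set \<times> ('m \<Rightarrow> 'e)"

abbreviation cdom :: "('m, 'e) chart \<Rightarrow> 'm set" where "cdom c \<equiv> fst c"
abbreviation cmap :: "('m, 'e) chart \<Rightarrow> 'm \<Rightarrow> 'e" where "cmap c \<equiv> snd c"
abbreviation cinv :: "('m, 'e) chart \<Rightarrow> 'e \<Rightarrow> 'm" where "cinv c \<equiv> inv_into (cdom c) (cmap c)"

definition is_chart :: "('m::topological_space, 'e::real_inner) chart \<Rightarrow> bool" where
  "is_chart c \<longleftrightarrow> open (cdom c) \<and> open (cmap c ` cdom c) \<and>
     homeomorphism (cdom c) (cmap c ` cdom c) (cmap c) (cinv c)"

definition smooth_atlas :: "('m::topological_space, 'e::real_inner) chart set \<Rightarrow> bool" where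
  "smooth_atlas A \<longleftrightarrow> (\<forall>c\<in>A. is_chart c) \<and> (\<Union>c\<in>A. cdom c) = UNIV \<and>
     (\<forall>c\<in>A. \<forall>c'\<in>A. smooth_on (cmap c' \<circ> cinv c) (cmap c ` (cdom c \<inter> cdom c')))"


section \<open>Tangent vectors\<close>

text \<open>A tangent vector at \<open>p\<close> is the family of its coordinate vectors in the charts around \<open>p\<close>,
  related by the differentials of the transition maps. The value \<open>0\<close> at all other arguments makes
  the representation unique. The vector space operations are pointwise.\<close>

type_synonym ('m, 'e) tvec = "('m, 'e) chart \<Rightarrow> 'e"

definition tangent_space :: "('m, 'e::real_inner) chart set \<Rightarrow> 'm \<Rightarrow> ('m, 'e) tvec set" where
  "tangent_space A p = {v.
     (\<forall>c\<in>A. \<forall>c'\<in>A. p \<in> cdom c \<inter> cdom c' \<longrightarrow>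
        v c' = frechet_derivative (cmap c' \<circ> cinv c) (at (cmap c p)) (v c)) \<and>
     (\<forall>c. \<not> (c \<in> A \<and> p \<in> cdom c) \<longrightarrow> v c = 0)}"

text \<open>The tangent vector at \<open>p\<close> whose coordinate vector in the chart \<open>c\<close> is \<open>a\<close>.\<close>

definition coord_vec :: "('m, 'e::real_inner) chart set \<Rightarrow> ('m, 'e) chart \<Rightarrow> 'm \<Rightarrow> 'e \<Rightarrow> ('m, 'e) tvec" where
  "coord_vec A c p a = (\<lambda>c'. if c' \<in> A \<and> p \<in> cdom c'
     then frechet_derivative (cmap c' \<circ> cinv c) (at (cmap c p)) a else 0)"


section \<open>Riemannian metrics\<close>

definition inner_product_on :: "('i \<Rightarrow> 'e::real_vector) set \<Rightarrow> (('i \<Rightarrow> 'e) \<Rightarrow> ('i \<Rightarrow> 'e) \<Rightarrow> real) \<Rightarrow> bool" where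
  "inner_product_on V B \<longleftrightarrow>
     (\<forall>u\<in>V. \<forall>v\<in>V. B u v = B v u) \<and>
     (\<forall>u\<in>V. \<forall>v\<in>V. \<forall>w\<in>V. B (\<lambda>i. u i + v i) w = B u w + B v w) \<and>
     (\<forall>r. \<forall>u\<in>V. \<forall>v\<in>V. B (\<lambda>i. r *\<^sub>R u i) v = r * B u v) \<and>
     (\<forall>u\<in>V. u \<noteq> (\<lambda>i. 0) \<longrightarrow> 0 < B u u)"

type_synonym ('m, 'e) metric_field = "'m \<Rightarrow> ('m, 'e) tvec \<Rightarrow> ('m, 'e) tvec \<Rightarrow> real"

text \<open>The smoothness condition says that the coefficients of the metric in each chart are smooth.\<close>

definition riemannian_metric ::
  "('m::topological_space, 'e::real_inner) chart set \<Rightarrow> ('m, 'e) metric_field \<Rightarrow> bool" where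
  "riemannian_metric A g \<longleftrightarrow>
     (\<forall>p. inner_product_on (tangent_space A p) (g p)) \<and>
     (\<forall>c\<in>A. \<forall>a b. smooth_on
        (\<lambda>x. g (cinv c x) (coord_vec A c (cinv c x) a) (coord_vec A c (cinv c x) b))
        (cmap c ` cdom c))"

definition tnorm :: "('m, 'e) metric_field \<Rightarrow> 'm \<Rightarrow> ('m, 'e) tvec \<Rightarrow> real" where
  "tnorm g p v = sqrt (g p v v)"


section \<open>Riemannian distance\<close>

text \<open>One-sided derivatives at \<open>a\<close> and \<open>b\<close> are included. The library's
  \<^const>\<open>piecewise_C1_differentiable_on\<close> is not used for the coordinate expressions of curves
  because it allows the derivative to be unbounded, even non-integrable, near a break point.\<close>

definition C1_curve_on ::
  "('m::topological_space, 'e::real_inner) chart set \<Rightarrow> (real \<Rightarrow> 'm) \<Rightarrow> real \<Rightarrow> real \<Rightarrow> bool" where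
  "C1_curve_on A \<gamma> a b \<longleftrightarrow> continuous_on {a..b} \<gamma> \<and>
     (\<forall>c\<in>A. \<exists>D. continuous_on {s\<in>{a..b}. \<gamma> s \<in> cdom c} D \<and>
        (\<forall>s\<in>{a..b}. \<gamma> s \<in> cdom c \<longrightarrow>
           ((cmap c \<circ> \<gamma>) has_vector_derivative D s) (at s within {a..b})))"

definition piecewise_C1_curve ::
  "('m::topological_space, 'e::real_inner) chart set \<Rightarrow> (real \<Rightarrow> 'm) \<Rightarrow> bool" where
  "piecewise_C1_curve A \<gamma> \<longleftrightarrow> (\<exists>(n::nat) (t::nat \<Rightarrow> real). t 0 = 0 \<and> t n = 1 \<and>
     (\<forall>i<n. t i < t (Suc i) \<and> C1_curve_on A \<gamma> (t i) (t (Suc i))))"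

definition velocity ::
  "('m, 'e::real_inner) chart set \<Rightarrow> (real \<Rightarrow> 'm) \<Rightarrow> real \<Rightarrow> ('m, 'e) tvec" where
  "velocity A \<gamma> t = (\<lambda>c. if c \<in> A \<and> \<gamma> t \<in> cdom c
     then vector_derivative (cmap c \<circ> \<gamma>) (at t) else 0)"

text \<open>At the end points and the finitely many break points the velocity has an arbitrary value,
  which does not affect the integral.\<close>

definition curve_length ::
  "('m, 'e::real_inner) chart set \<Rightarrow> ('m, 'e) metric_field \<Rightarrow> (real \<Rightarrow> 'm) \<Rightarrow> real" where
  "curve_length A g \<gamma> = integral {0..1} (\<lambda>t. tnorm g (\<gamma> t) (velocity A \<gamma> t))"

definition riem_dist ::
  "('m::topological_space, 'e::real_inner) chart set \<Rightarrow> ('m, 'e) metric_field \<Rightarrow> 'm \<Rightarrow> 'm \<Rightarrow> real" where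
  "riem_dist A g p q =
     Inf {curve_length A g \<gamma> | \<gamma>. piecewise_C1_curve A \<gamma> \<and> \<gamma> 0 = p \<and> \<gamma> 1 = q}"


section \<open>Complete Riemannian manifolds\<close>

text \<open>Finite-dimensionality of the model space is stated by a finite spanning set rather than by
  the class \<^class>\<open>euclidean_space\<close>, which would exclude dimension \<open>0\<close>.\<close>

definition complete_riemannian_manifold ::
  "('m::{t2_space,second_countable_topology}, 'e::real_inner) chart set \<Rightarrow>
   ('m, 'e) metric_field \<Rightarrow> bool" where
  "complete_riemannian_manifold A g \<longleftrightarrow>
     (\<exists>B::'e set. finite B \<and> span B = UNIV) \<and>
     connected (UNIV :: 'm set) \<and> smooth_atlas A \<and> riemannian_metric A g \<and>
     Metric_space.mcomplete UNIV (riem_dist A g)"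


section \<open>Gradients\<close>

definition C1_function :: "('m, 'e::real_inner) chart set \<Rightarrow> ('m \<Rightarrow> real) \<Rightarrow> bool" where
  "C1_function A f \<longleftrightarrow> (\<forall>c\<in>A. Ck_on 1 (f \<circ> cinv c) (cmap c ` cdom c))"

text \<open>The value of the differential of \<open>f\<close> at \<open>p\<close> on a tangent vector \<open>v\<close>, computed in any chart
  around \<open>p\<close>.\<close>

definition differential ::
  "('m, 'e::real_inner) chart set \<Rightarrow> ('m \<Rightarrow> real) \<Rightarrow> 'm \<Rightarrow> ('m, 'e) tvec \<Rightarrow> real" where
  "differential A f p v = (THE r. \<forall>c\<in>A. p \<in> cdom c \<longrightarrow>
     r = frechet_derivative (f \<circ> cinv c) (at (cmap c p)) (v c))"

definition gradient ::
  "('m, 'e::real_inner) chart set \<Rightarrow> ('m, 'e) metric_field \<Rightarrow> ('m \<Rightarrow> real) \<Rightarrow> 'm \<Rightarrow> ('m, 'e) tvec" where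
  "gradient A g f p = (THE v. v \<in> tangent_space A p \<and>
     (\<forall>w\<in>tangent_space A p. g p v w = differential A f p w))"

end

theory Submission
  imports Defs
begin

text \<open>Ekeland's variational principle on \<open>(M, d)\<close> with parameter \<open>\<epsilon> \<approx> sqrt (f x - inf f)\<close> gives a
  point \<open>y\<close> with \<open>d x y \<le> \<epsilon>\<close>, \<open>f y \<le> f x\<close> and \<open>f y \<le> f z + \<epsilon> * d y z\<close> for all \<open>z\<close>. Moving from
  \<open>y\<close> along a chart segment with initial velocity \<open>- grad f y\<close> bounds the norm of the gradient by
  \<open>\<epsilon>\<close>. Completeness is only usable once \<open>d\<close> is known to be a metric that refines the manifold
  topology. For this, in a compact chart ball \<open>g\<close> dominates a multiple of the Euclidean metric, so
  leaving the ball costs a definite length.\<close>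

section \<open>Finite-dimensional inner product spaces\<close>

text \<open>The square root balances two demands. Ekeland's principle gives
  \<open>\<epsilon> * d x y \<le> f x - f y\<close>, hence a displacement of at most (f x - inf f) /
  \<epsilon>, while the gradient at \<open>y\<close> is at most \<epsilon>; both are small when
  \<epsilon> is of the order of sqrt (f x - inf f). The obstacle is that regularity of
  \<open>f\<close> is given in charts, hence for the manifold topology, whereas the variational
  principle speaks of limits in \<open>d\<close>. \<open>riem_dist_refines\<close> is the bridge; it
  also yields definiteness of \<open>d\<close>. An upper bound for \<open>d\<close> is required only
  to first order at one point, as \<open>d\<close> from \<open>y\<close> to the point at time t of a
  chart segment, so no geodesics appear. Tangent vectors are families indexed by charts, and the
  velocity at a break point carries no meaning. Estimates are therefore made for the coefficient
  form of the metric in a single chart, and only at all but finitely many parameters.\<close>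

locale inner_form =
  fixes B :: "'a::real_vector \<Rightarrow> 'a \<Rightarrow> real"
  assumes sym: "B x y = B y x"
    and add_left: "B (x + y) z = B x z + B y z"
    and scale_left: "B (r *\<^sub>R x) y = r * B x y"
    and pos: "x \<noteq> 0 \<Longrightarrow> 0 < B x x"
begin

lemma add_right: "B z (x + y) = B z x + B z y"
  by (metis add_left sym)

lemma scale_right: "B y (r *\<^sub>R x) = r * B y x"
  by (metis scale_left sym)

lemma zero_left [simp]: "B 0 y = 0"
  using scale_left[of 0 0 y] by simp

lemma zero_right [simp]: "B y 0 = 0"
  using sym[of y 0] by simp

lemma minus_left: "B (- x) y = - B x y"
  using scale_left[of "-1" x y] by simp

lemma diff_left: "B (x - y) z = B x z - B y z"
  using add_left[of x "- y" z] by (simp add: minus_left)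

lemma nonneg: "0 \<le> B x x"
  using pos[of x] by (cases "x = 0") auto

lemma sum_left: "B (\<Sum>i\<in>I. h i) y = (\<Sum>i\<in>I. B (h i) y)"
  by (induction I rule: infinite_finite_induct) (auto simp: add_left)

lemma sum_right: "B y (\<Sum>i\<in>I. h i) = (\<Sum>i\<in>I. B y (h i))"
  by (induction I rule: infinite_finite_induct) (auto simp: add_right)

lemma expansion_in_span:
  assumes "finite E" "\<And>e e'. e \<in> E \<Longrightarrow> e' \<in> E \<Longrightarrow> B e e' = (if e = e' then 1 else 0)" "x \<in> span E"
  shows "x = (\<Sum>e\<in>E. B x e *\<^sub>R e)"
  using assms(3)
proof (induction rule: span_induct_alt)
  case base
  then show ?case by simp
next
  case (step c v y)
  have "(\<Sum>e\<in>E. B v e *\<^sub>R e) = (\<Sum>e\<in>E. if v = e then e else 0)"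
    by (rule sum.cong) (use assms(2) step in auto)
  also have "\<dots> = v"
    using assms(1) step by simp
  finally have "(\<Sum>e\<in>E. B v e *\<^sub>R e) = v" .
  then show ?case
    using step
    by (simp add: add_left scale_left scaleR_left_distrib sum.distrib flip: scaleR_scaleR scaleR_sum_right)
qed

text \<open>Gram-Schmidt on the spanning set. The form is kept arbitrary because two are needed:
  \<open>inner\<close> on the model space, and the coefficients of the Riemannian metric in a
  chart.\<close>

lemma orthonormal_span:
  assumes "finite S"
  shows "\<exists>E. finite E \<and> span E = span S \<and>
    (\<forall>e\<in>E. \<forall>e'\<in>E. B e e' = (if e = e' then 1 else 0))"
  using assms
proof induction
  case empty
  then show ?case by (intro exI[of _ "{}"]) auto
next
  case (insert s S)
  then obtain E where E: "finite E" "span E = span S"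
    "\<And>e e'. e \<in> E \<Longrightarrow> e' \<in> E \<Longrightarrow> B e e' = (if e = e' then 1 else 0)"
    by blast
  define p where "p = (\<Sum>e\<in>E. B s e *\<^sub>R e)"
  have p: "p \<in> span E"
    unfolding p_def by (intro span_sum span_scale span_base)
  show ?case
  proof (cases "s = p")
    case True
    then have "span (insert s S) = span S"
      using p E(2) by (simp add: span_redundant)
    then show ?thesis using E by auto
  next
    case False
    define n where "n = sqrt (B (s - p) (s - p))"
    have n: "n > 0" "n * n = B (s - p) (s - p)"
      using pos[of "s - p"] False by (auto simp: n_def)
    define w where "w = (1 / n) *\<^sub>R (s - p)"
    have ww: "B w w = 1"
      using n(1) by (simp add: w_def scale_left scale_right flip: n(2))
    have we: "B w e = 0" if "e \<in> E" for e
    proof -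
      have "B p e = (\<Sum>e'\<in>E. if e' = e then B s e else 0)"
        unfolding p_def sum_left by (rule sum.cong) (use E that in \<open>auto simp: scale_left\<close>)
      also have "\<dots> = B s e" using E that by simp
      finally show ?thesis by (simp add: w_def scale_left diff_left)
    qed
    have ew: "B e w = 0" if "e \<in> E" for e
      using we[OF that] by (simp add: sym)
    have "span (insert w E) = span (insert s E)"
    proof (rule span_eq[THEN iffD2], intro conjI subsetI)
      fix y assume "y \<in> insert w E"
      moreover have "p \<in> span (insert s E)" using p span_mono[of E "insert s E"] by auto
      ultimately show "y \<in> span (insert s E)"
        by (auto simp: w_def intro!: span_scale span_diff intro: span_base)
    next
      fix y assume y: "y \<in> insert s E"
      have "s = n *\<^sub>R w + p" using n by (simp add: w_def)
      moreover have "p \<in> span (insert w E)" using p span_mono[of E "insert w E"] by auto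
      ultimately have "s \<in> span (insert w E)"
        by (metis insertI1 span_add span_base span_scale)
      then show "y \<in> span (insert w E)" using y by (auto intro: span_base)
    qed
    also have "\<dots> = span (insert s S)"
      using E(2) by (simp add: span_insert)
    finally have "span (insert w E) = span (insert s S)" .
    moreover have "w \<notin> E" using we[of w] ww by (metis zero_neq_one)
    then have "B e e' = (if e = e' then 1 else 0)" if "e \<in> insert w E" "e' \<in> insert w E" for e e'
      using that E(3)[of e e'] ww we[of e'] ew[of e] by (cases "e = w"; cases "e' = w") auto
    ultimately show ?thesis
      using E(1) by (intro exI[of _ "insert w E"] conjI ballI) simp_all
  qed
qed

lemma orthonormal_basis:
  assumes "finite S" "span S = (UNIV :: 'a set)"
  obtains E where "finite E" "\<And>x. x = (\<Sum>e\<in>E. B x e *\<^sub>R e)"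
proof -
  obtain E where E: "finite E" "span E = span S"
    "\<And>e e'. e \<in> E \<Longrightarrow> e' \<in> E \<Longrightarrow> B e e' = (if e = e' then 1 else 0)"
    using orthonormal_span[OF assms(1)] by blast
  show ?thesis
    by (rule that[of E]) (use E assms expansion_in_span in auto)
qed

text \<open>The representing vector is the sum of \<open>\<phi> e *\<^sub>R e\<close> over an
  orthonormal basis for \<open>B\<close>. With \<open>B\<close> the metric at a point this produces
  the gradient.\<close>

lemma riesz:
  assumes "finite S" "span S = (UNIV :: 'a set)" "linear \<phi>"
  obtains v where "\<And>w. B v w = \<phi> w"
proof -
  obtain E where E: "finite E" "\<And>x. x = (\<Sum>e\<in>E. B x e *\<^sub>R e)"
    using orthonormal_basis[OF assms(1,2)] by blast
  have "B (\<Sum>e\<in>E. \<phi> e *\<^sub>R e) w = \<phi> w" for w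
  proof -
    have "\<phi> w = \<phi> (\<Sum>e\<in>E. B w e *\<^sub>R e)" using E(2)[of w] by simp
    also have "\<dots> = (\<Sum>e\<in>E. B w e * \<phi> e)"
      using assms(3) by (simp add: linear_sum linear_scale)
    also have "\<dots> = (\<Sum>e\<in>E. \<phi> e * B e w)"
      by (intro sum.cong refl) (subst sym, rule mult.commute)
    finally show ?thesis
      by (simp add: sum_left scale_left)
  qed
  then show ?thesis by (rule that)
qed

end

text \<open>Heine-Borel has to come from the spanning set, since the model type is only of class
  \<open>real_inner\<close>. Combinations with bounded coefficients form a compact set, built one
  vector at a time as the image of an interval times the previous set, and they contain the
  ball.\<close>

lemma compact_cball_finite_span:
  fixes z :: "'e::real_inner"
  assumes "finite S" "span S = (UNIV :: 'e set)"
  shows "compact (cball z r)"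
proof -
  interpret inner_form "inner :: 'e \<Rightarrow> 'e \<Rightarrow> real"
    by unfold_locales (simp_all add: inner_add_left, rule inner_commute)
  obtain E where E: "finite E" "\<And>x::'e. x = (\<Sum>e\<in>E. inner x e *\<^sub>R e)"
    using orthonormal_basis[OF assms] by blast
  \<comment> \<open>The bound is Cauchy-Schwarz for \<open>inner x e\<close> with
    \<open>norm x \<le> norm z + r\<close>. The factor \<open>norm e\<close> stays because only the
    expansion property of \<open>E\<close> is at hand, not that its vectors have length one.\<close>
  define K where "K F = {\<Sum>e\<in>F. a e *\<^sub>R e | a. \<forall>e\<in>F. a e \<in> {- (norm e * (norm z + r))..norm e * (norm z + r)}}"
    for F :: "'e set"
  have "compact (K F)" if "finite F" for F
    using that
  proof induction
    case empty
    then show ?case by (simp add: K_def)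
  next
    case (insert b F)
    let ?I = "{- (norm b * (norm z + r))..norm b * (norm z + r)}"
    have "K (insert b F) = (\<lambda>(t, k). t *\<^sub>R b + k) ` (?I \<times> K F)" (is "?L = ?R")
    proof
      show "?L \<subseteq> ?R"
      proof
        fix y assume "y \<in> ?L"
        then obtain a where a: "y = (\<Sum>e\<in>insert b F. a e *\<^sub>R e)"
          "\<forall>e\<in>insert b F. a e \<in> {- (norm e * (norm z + r))..norm e * (norm z + r)}"
          unfolding K_def by blast
        then have "y = a b *\<^sub>R b + (\<Sum>e\<in>F. a e *\<^sub>R e)" "a b \<in> ?I" "(\<Sum>e\<in>F. a e *\<^sub>R e) \<in> K F"
          using insert(1,2) unfolding K_def by auto
        then show "y \<in> ?R" by (intro image_eqI[of _ _ "(a b, \<Sum>e\<in>F. a e *\<^sub>R e)"]) auto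
      qed
      show "?R \<subseteq> ?L"
      proof safe
        fix t k assume t: "t \<in> ?I" and "k \<in> K F"
        then obtain a where a: "k = (\<Sum>e\<in>F. a e *\<^sub>R e)"
          "\<forall>e\<in>F. a e \<in> {- (norm e * (norm z + r))..norm e * (norm z + r)}"
          unfolding K_def by blast
        have "(\<Sum>e\<in>F. (if e = b then t else a e) *\<^sub>R e) = k"
          unfolding a(1) by (rule sum.cong) (use insert in auto)
        then have "t *\<^sub>R b + k = (\<Sum>e\<in>insert b F. (if e = b then t else a e) *\<^sub>R e)"
          using insert(1,2) by simp
        then show "t *\<^sub>R b + k \<in> ?L"
          unfolding K_def using a t by (intro CollectI exI[of _ "\<lambda>e. if e = b then t else a e"]) auto
      qed
    qed
    moreover have "compact ((\<lambda>(t, k). t *\<^sub>R b + k) ` (?I \<times> K F))"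
      using insert(3) by (intro compact_continuous_image compact_Times) (auto intro!: continuous_intros simp: case_prod_beta)
    ultimately show ?case by simp
  qed
  then have "compact (K E)" using E by auto
  moreover have "cball z r \<subseteq> K E"
  proof
    fix x assume x: "x \<in> cball z r"
    have "norm x \<le> norm z + r"
      using x norm_triangle_ineq2[of x z] by (simp add: dist_norm norm_minus_commute)
    then have "\<bar>inner x e\<bar> \<le> norm e * (norm z + r)" for e
      using Cauchy_Schwarz_ineq2[of x e] mult_left_mono[of "norm x" "norm z + r" "norm e"]
      by (simp add: mult.commute)
    then have "inner x e \<in> {- (norm e * (norm z + r))..norm e * (norm z + r)}" for e
      by (auto simp: abs_le_iff minus_le_iff)
    then show "x \<in> K E"
      unfolding K_def by (intro CollectI exI[of _ "inner x"] conjI ballI E(2))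
  qed
  ultimately show ?thesis
    using compact_Int_closed[of "K E" "cball z r"] by (simp add: Int_absorb1)
qed

section \<open>The metric in charts\<close>

locale riemannian_manifold =
  fixes A :: "('m::{t2_space,second_countable_topology}, 'e::real_inner) chart set"
    and g :: "('m, 'e) metric_field"
  assumes finite_dimensional: "\<exists>B::'e set. finite B \<and> span B = UNIV"
    and connected_space: "connected (UNIV :: 'm set)"
    and atlas: "smooth_atlas A"
    and metric: "riemannian_metric A g"
begin

section \<open>Charts, their inverses and chart balls\<close>

lemma chart_at: obtains c where "c \<in> A" "p \<in> cdom c"
  using atlas unfolding smooth_atlas_def by blast

lemma chart:
  assumes "c \<in> A"
  shows open_cdom: "open (cdom c)"
    and open_image: "open (cmap c ` cdom c)"
    and continuous_cmap: "continuous_on (cdom c) (cmap c)"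
    and continuous_cinv: "continuous_on (cmap c ` cdom c) (cinv c)"
    and inj_cmap: "inj_on (cmap c) (cdom c)"
  using atlas assms unfolding smooth_atlas_def is_chart_def homeomorphism_def
  by (auto intro: inj_on_inverseI[of _ "cinv c"])

lemma cinv_cmap: "c \<in> A \<Longrightarrow> p \<in> cdom c \<Longrightarrow> cinv c (cmap c p) = p"
  by (simp add: inj_cmap)

lemma cinv_in: "x \<in> cmap c ` cdom c \<Longrightarrow> cinv c x \<in> cdom c"
  by (rule inv_into_into)

lemma cmap_cinv: "x \<in> cmap c ` cdom c \<Longrightarrow> cmap c (cinv c x) = x"
  by (rule f_inv_into_f)

lemma open_cmap_image:
  assumes "c \<in> A" "open U"
  shows "open (cmap c ` (cdom c \<inter> U))"
proof -
  have "cmap c ` (cdom c \<inter> U) = cmap c ` cdom c \<inter> cinv c -` U"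
    using cinv_cmap[OF assms(1)] by auto
  then show ?thesis
    using continuous_open_preimage[OF continuous_cinv open_image assms(2)] assms(1) by simp
qed

lemma open_cinv_image:
  assumes "c \<in> A" "open W"
  shows "open (cinv c ` (cmap c ` cdom c \<inter> W))"
proof -
  have "cinv c ` (cmap c ` cdom c \<inter> W) = cdom c \<inter> cmap c -` W"
  proof
    show "cinv c ` (cmap c ` cdom c \<inter> W) \<subseteq> cdom c \<inter> cmap c -` W"
      by (auto simp: cinv_cmap[OF assms(1)])
    show "cdom c \<inter> cmap c -` W \<subseteq> cinv c ` (cmap c ` cdom c \<inter> W)"
    proof
      fix p assume "p \<in> cdom c \<inter> cmap c -` W"
      then show "p \<in> cinv c ` (cmap c ` cdom c \<inter> W)"
        using cinv_cmap[OF assms(1), of p] by (intro image_eqI[of _ _ "cmap c p"]) auto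
    qed
  qed
  then show ?thesis
    using continuous_open_preimage[OF continuous_cmap open_cdom assms(2)] assms(1) by simp
qed

lemma ball_in_chart:
  assumes "c \<in> A" "p \<in> cdom c" "open U" "p \<in> U"
  obtains r where "r > 0" "cball (cmap c p) r \<subseteq> cmap c ` (cdom c \<inter> U)"
proof -
  have "cmap c p \<in> cmap c ` (cdom c \<inter> U)" using assms by blast
  then show ?thesis
    using open_contains_cball[THEN iffD1, OF open_cmap_image[OF assms(1,3)]] that by blast
qed

section \<open>Differentials of transition maps and coordinates of tangent vectors\<close>

abbreviation dtr :: "('m, 'e) chart \<Rightarrow> ('m, 'e) chart \<Rightarrow> 'm \<Rightarrow> 'e \<Rightarrow> 'e" where
  "dtr c c' p \<equiv> frechet_derivative (cmap c' \<circ> cinv c) (at (cmap c p))"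

lemma transition:
  assumes "c \<in> A" "c' \<in> A"
  shows transition_differentiable:
      "p \<in> cdom c \<inter> cdom c' \<Longrightarrow> (cmap c' \<circ> cinv c) differentiable (at (cmap c p))"
    and transition_C1:
      "continuous_on (cmap c ` (cdom c \<inter> cdom c')) (\<lambda>x. frechet_derivative (cmap c' \<circ> cinv c) (at x) v)"
proof -
  have "Ck_on (Suc 0) (cmap c' \<circ> cinv c) (cmap c ` (cdom c \<inter> cdom c'))"
    using atlas assms unfolding smooth_atlas_def smooth_on_def by blast
  then show "p \<in> cdom c \<inter> cdom c' \<Longrightarrow> (cmap c' \<circ> cinv c) differentiable (at (cmap c p))"
    "continuous_on (cmap c ` (cdom c \<inter> cdom c')) (\<lambda>x. frechet_derivative (cmap c' \<circ> cinv c) (at x) v)"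
    by auto
qed

lemma transition_has_derivative:
  assumes "c \<in> A" "c' \<in> A" "p \<in> cdom c" "p \<in> cdom c'"
  shows "((cmap c' \<circ> cinv c) has_derivative dtr c c' p) (at (cmap c p))"
  using transition_differentiable[of c c' p] assms frechet_derivative_works by blast

lemma linear_dtr:
  assumes "c \<in> A" "c' \<in> A" "p \<in> cdom c" "p \<in> cdom c'"
  shows "linear (dtr c c' p)"
  using transition_has_derivative[OF assms] has_derivative_linear by blast

text \<open>\<open>h \<circ> cinv c\<close> is \<open>h \<circ> cinv c'\<close> after the transition
  map, but only on the image of the overlap; this is open, so the chain rule applies. With
  \<open>h\<close> a third coordinate map this becomes the cocycle rule; with \<open>h\<close> a
  function on the manifold it shows that its differential does not depend on the chart.\<close>

lemma dtr_chain:
  assumes "c \<in> A" "c' \<in> A" "p \<in> cdom c" "p \<in> cdom c'"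
    and h: "((h \<circ> cinv c') has_derivative D) (at (cmap c' p))"
  shows "((h \<circ> cinv c) has_derivative (\<lambda>a. D (dtr c c' p a))) (at (cmap c p))"
proof -
  have eq: "(cmap c' \<circ> cinv c) (cmap c p) = cmap c' p"
    using assms by (simp add: cinv_cmap)
  have "((\<lambda>x. (h \<circ> cinv c') ((cmap c' \<circ> cinv c) x)) has_derivative (\<lambda>a. D (dtr c c' p a))) (at (cmap c p))"
    by (rule has_derivative_compose[OF transition_has_derivative[OF assms(1-4)]])
      (simp only: eq h)
  then show ?thesis
  proof (rule has_derivative_transform_within_open)
    show "open (cmap c ` (cdom c \<inter> cdom c'))" using assms open_cdom open_cmap_image by blast
    show "cmap c p \<in> cmap c ` (cdom c \<inter> cdom c')" using assms by blast
  qed (use assms in \<open>auto simp: cinv_cmap\<close>)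
qed

lemma dtr_self:
  assumes "c \<in> A" "p \<in> cdom c"
  shows "dtr c c p a = a"
proof -
  have "((cmap c \<circ> cinv c) has_derivative (\<lambda>a. a)) (at (cmap c p))"
    by (rule has_derivative_transform_within_open[OF has_derivative_ident open_image[OF assms(1)]])
      (use assms in \<open>auto simp: cmap_cinv\<close>)
  then show ?thesis using frechet_derivative_at by metis
qed

text \<open>The cocycle rule; it is what makes \<open>coord_vec\<close> satisfy the compatibility
  condition in \<open>tangent_space\<close>.\<close>

lemma dtr_dtr:
  assumes "c \<in> A" "c' \<in> A" "c'' \<in> A" "p \<in> cdom c" "p \<in> cdom c'" "p \<in> cdom c''"
  shows "dtr c' c'' p (dtr c c' p a) = dtr c c'' p a"
  using frechet_derivative_at[OF dtr_chain[OF assms(1,2,4,5)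
      transition_has_derivative[OF assms(2,3,5,6)]]] by metis

lemma coord_vec_self:
  "c \<in> A \<Longrightarrow> p \<in> cdom c \<Longrightarrow> coord_vec A c p a c = a"
  by (simp add: coord_vec_def dtr_self)

lemma coord_vec_tangent:
  assumes "c \<in> A" "p \<in> cdom c"
  shows "coord_vec A c p a \<in> tangent_space A p"
  using assms by (auto simp: tangent_space_def coord_vec_def dtr_dtr)

text \<open>Together with \<open>coord_vec_self\<close>, evaluation at one chart identifies the
  tangent space with \<open>'e\<close>. In this way norms, Riesz representation and uniqueness of
  the gradient are moved to the fixed model space.\<close>

lemma tangent_eq_coord_vec:
  assumes "c \<in> A" "p \<in> cdom c" "v \<in> tangent_space A p"
  shows "v = coord_vec A c p (v c)"
proof (rule ext)
  fix c'
  have "v c' = dtr c c' p (v c)" if "c' \<in> A" "p \<in> cdom c'"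
    using assms that unfolding tangent_space_def by blast
  moreover have "v c' = 0" if "\<not> (c' \<in> A \<and> p \<in> cdom c')"
    using assms that unfolding tangent_space_def by blast
  ultimately show "v c' = coord_vec A c p (v c) c'"
    unfolding coord_vec_def by presburger
qed

lemma coord_vec_add:
  assumes "c \<in> A" "p \<in> cdom c"
  shows "coord_vec A c p (a + b) = (\<lambda>i. coord_vec A c p a i + coord_vec A c p b i)"
proof (rule ext)
  fix c'
  show "coord_vec A c p (a + b) c' = coord_vec A c p a c' + coord_vec A c p b c'"
    using linear_add[OF linear_dtr[OF assms(1) _ assms(2)], of c'] by (simp add: coord_vec_def)
qed

lemma coord_vec_scale:
  assumes "c \<in> A" "p \<in> cdom c"
  shows "coord_vec A c p (r *\<^sub>R a) = (\<lambda>i. r *\<^sub>R coord_vec A c p a i)"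
proof (rule ext)
  fix c'
  show "coord_vec A c p (r *\<^sub>R a) c' = r *\<^sub>R coord_vec A c p a c'"
    using linear_scale[OF linear_dtr[OF assms(1) _ assms(2)], of c'] by (simp add: coord_vec_def)
qed

text \<open>The coefficient form (g_ij) of the metric at the coordinate point \<open>z\<close>. It
  lives on the same space \<open>'e\<close> for every \<open>z\<close>, so that joint continuity and
  compactness in point and vector make sense.\<close>

definition chart_metric :: "('m, 'e) chart \<Rightarrow> 'e \<Rightarrow> 'e \<Rightarrow> 'e \<Rightarrow> real" where
  "chart_metric c z a b = g (cinv c z) (coord_vec A c (cinv c z) a) (coord_vec A c (cinv c z) b)"

lemma inner_form_chart_metric:
  assumes "c \<in> A" "z \<in> cmap c ` cdom c"
  shows "inner_form (chart_metric c z)"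
proof -
  let ?p = "cinv c z"
  have p: "?p \<in> cdom c" using assms by (simp add: cinv_in)
  have T: "coord_vec A c ?p a \<in> tangent_space A ?p" for a
    by (rule coord_vec_tangent[OF assms(1) p])
  have ip: "inner_product_on (tangent_space A ?p) (g ?p)"
    using metric unfolding riemannian_metric_def by blast
  note ip = ip[unfolded inner_product_on_def]
  note sym = ip[THEN conjunct1, rule_format]
    and add = ip[THEN conjunct2, THEN conjunct1, rule_format]
    and scale = ip[THEN conjunct2, THEN conjunct2, THEN conjunct1, rule_format]
    and pos = ip[THEN conjunct2, THEN conjunct2, THEN conjunct2, rule_format]
  have nz: "coord_vec A c ?p a \<noteq> (\<lambda>i. 0)" if "a \<noteq> 0" for a
  proof
    assume "coord_vec A c ?p a = (\<lambda>i. 0)"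
    from fun_cong[OF this, of c] show False
      using coord_vec_self[OF assms(1) p, of a] that by simp
  qed
  show ?thesis
  proof
    fix a b d :: 'e and r :: real
    show "chart_metric c z a b = chart_metric c z b a"
      unfolding chart_metric_def by (rule sym[OF T T])
    show "chart_metric c z (a + b) d = chart_metric c z a d + chart_metric c z b d"
      unfolding chart_metric_def coord_vec_add[OF assms(1) p] by (rule add[OF T T T])
    show "chart_metric c z (r *\<^sub>R a) b = r * chart_metric c z a b"
      unfolding chart_metric_def coord_vec_scale[OF assms(1) p] by (rule scale[OF T T])
    show "0 < chart_metric c z a a" if "a \<noteq> 0"
      unfolding chart_metric_def by (rule pos[OF T nz[OF that]])
  qed
qed

lemma tnorm_chart:
  assumes "c \<in> A" "p \<in> cdom c" "v \<in> tangent_space A p"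
  shows "tnorm g p v = sqrt (chart_metric c (cmap c p) (v c) (v c))"
  using tangent_eq_coord_vec[OF assms] assms by (simp add: tnorm_def chart_metric_def cinv_cmap)

text \<open>Smoothness of the metric speaks of fixed vectors only. Expanding \<open>a s\<close> in a
  basis orthonormal for \<open>inner\<close>, hence independent of \<open>s\<close>, leaves a finite
  sum of products of continuous functions.\<close>

lemma continuous_on_chart_metric:
  assumes c: "c \<in> A" and z: "continuous_on S z" "\<And>s. s \<in> S \<Longrightarrow> z s \<in> cmap c ` cdom c"
    and a: "continuous_on S a"
  shows "continuous_on S (\<lambda>s. chart_metric c (z s) (a s) (a s))"
proof -
  obtain B :: "'e set" where B: "finite B" "span B = UNIV" using finite_dimensional by blast
  interpret i: inner_form "inner :: 'e \<Rightarrow> 'e \<Rightarrow> real"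
    by unfold_locales (simp_all add: inner_add_left, rule inner_commute)
  obtain E where E: "finite E" "\<And>x::'e. x = (\<Sum>e\<in>E. inner x e *\<^sub>R e)"
    using i.orthonormal_basis[OF B] by blast
  have eq: "chart_metric c (z s) (a s) (a s) =
      (\<Sum>e\<in>E. \<Sum>e'\<in>E. inner (a s) e * inner (a s) e' * chart_metric c (z s) e e')" if "s \<in> S" for s
  proof -
    interpret f: inner_form "chart_metric c (z s)" using inner_form_chart_metric[OF c z(2)[OF that]] .
    have "chart_metric c (z s) (a s) (a s) =
       chart_metric c (z s) (\<Sum>e\<in>E. inner (a s) e *\<^sub>R e) (\<Sum>e\<in>E. inner (a s) e *\<^sub>R e)"
      using E(2)[of "a s"] by (rule arg_cong2[OF _ E(2)[of "a s"]])
    also have "\<dots> = (\<Sum>e\<in>E. \<Sum>e'\<in>E. inner (a s) e * inner (a s) e' * chart_metric c (z s) e e')"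
      unfolding f.sum_left f.scale_left
      unfolding f.sum_right f.scale_right sum_distrib_left mult.assoc ..
    finally show ?thesis .
  qed
  have [continuous_intros]: "continuous_on S (\<lambda>s. chart_metric c (z s) e e')" for e e'
  proof -
    have "Ck_on 0 (\<lambda>x. chart_metric c x e e') (cmap c ` cdom c)"
      using metric c unfolding riemannian_metric_def smooth_on_def chart_metric_def by blast
    then have "continuous_on (cmap c ` cdom c) (\<lambda>x. chart_metric c x e e')" by simp
    then show ?thesis
      by (rule continuous_on_compose2[OF _ z(1)]) (use z in auto)
  qed
  have "continuous_on S (\<lambda>s. \<Sum>e\<in>E. \<Sum>e'\<in>E. inner (a s) e * inner (a s) e' * chart_metric c (z s) e e')"
    by (intro continuous_intros a)
  then show ?thesis
    by (rule continuous_on_eq) (simp only: eq)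
qed

text \<open>The quadratic form is continuous and positive on the compact set of pairs of a point of
  the ball and a unit vector, so it has a positive minimum there. Homogeneity extends the bound to
  all vectors, with \<open>k\<close> the square root of that minimum.\<close>

lemma chart_metric_lower_bound:
  assumes "c \<in> A" "cball z r \<subseteq> cmap c ` cdom c" "0 \<le> r"
  obtains k where "k > 0" "\<And>x a. x \<in> cball z r \<Longrightarrow> k * norm a \<le> sqrt (chart_metric c x a a)"
proof (cases "\<exists>u::'e. norm u = 1")
  \<comment> \<open>In dimension 0 the unit sphere is empty and there is no minimum; every vector
    has norm 0, so \<open>k = 1\<close> serves.\<close>
  case False
  then have na: "norm a = 0" for a :: 'e
    using norm_sgn[of a] by (metis norm_eq_zero)
  have "1 * norm a \<le> sqrt (chart_metric c x a a)" if "x \<in> cball z r" for x a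
    unfolding na using inner_form.nonneg[OF inner_form_chart_metric[OF assms(1)], of x a] assms(2) that by auto
  then show ?thesis using that[of 1] by simp
next
  case True
  obtain B :: "'e set" where B: "finite B" "span B = UNIV" using finite_dimensional by blast
  have closed_sph: "closed (sphere (0::'e) 1)"
    unfolding sphere_def by (intro closed_Collect_eq continuous_intros)
  have "sphere (0::'e) 1 = cball 0 1 \<inter> sphere 0 1" by auto
  then have "compact (sphere (0::'e) 1)"
    using compact_Int_closed[OF compact_cball_finite_span[OF B, of 0 1] closed_sph] by simp
  then have "compact (cball z r \<times> sphere (0::'e) 1)"
    using compact_cball_finite_span[OF B] by (intro compact_Times)
  moreover have "cball z r \<times> sphere (0::'e) 1 \<noteq> {}"
    using True assms(3) by (auto intro: exI[of _ z])
  moreover have "continuous_on (cball z r \<times> sphere (0::'e) 1) (\<lambda>s. chart_metric c (fst s) (snd s) (snd s))"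
    by (rule continuous_on_chart_metric[OF assms(1)]) (use assms in \<open>auto intro!: continuous_intros\<close>)
  ultimately have "\<exists>s\<in>cball z r \<times> sphere (0::'e) 1. \<forall>t\<in>cball z r \<times> sphere 0 1.
      chart_metric c (fst s) (snd s) (snd s) \<le> chart_metric c (fst t) (snd t) (snd t)"
    by (rule continuous_attains_inf)
  then obtain s where s: "s \<in> cball z r \<times> sphere (0::'e) 1"
    "\<And>t. t \<in> cball z r \<times> sphere (0::'e) 1 \<Longrightarrow>
      chart_metric c (fst s) (snd s) (snd s) \<le> chart_metric c (fst t) (snd t) (snd t)"
    by blast
  let ?k = "chart_metric c (fst s) (snd s) (snd s)"
  have "snd s \<noteq> 0" using s(1) by auto
  then have k: "0 < ?k"
    using inner_form.pos[OF inner_form_chart_metric[OF assms(1)], of "fst s" "snd s"] s(1) assms(2) by auto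
  have "sqrt ?k * norm a \<le> sqrt (chart_metric c x a a)" if "x \<in> cball z r" for x a
  proof (cases "a = 0")
    case True
    then show ?thesis
      using inner_form.nonneg[OF inner_form_chart_metric[OF assms(1)], of x a] assms(2) that True by auto
  next
    case False
    interpret f: inner_form "chart_metric c x" using inner_form_chart_metric[OF assms(1)] that assms(2) by blast
    have "?k \<le> chart_metric c x (sgn a) (sgn a)"
      using s(2)[of "(x, sgn a)"] that False by (simp add: norm_sgn)
    also have "\<dots> = chart_metric c x a a / (norm a)\<^sup>2"
      by (simp add: sgn_div_norm f.scale_left f.scale_right power2_eq_square field_simps)
    finally have "?k * (norm a)\<^sup>2 \<le> chart_metric c x a a"
      using False by (simp add: field_simps)
    then have "sqrt (?k * (norm a)\<^sup>2) \<le> sqrt (chart_metric c x a a)" by simp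
    then show ?thesis by (simp add: real_sqrt_mult)
  qed
  then show ?thesis using that[of "sqrt ?k"] k by simp
qed

end

section \<open>Piecewise C1 curves\<close>

lemma C1_curve_on_subset:
  assumes "C1_curve_on A \<gamma> a b" "{a'..b'} \<subseteq> {a..b}"
  shows "C1_curve_on A \<gamma> a' b'"
  unfolding C1_curve_on_def
proof (intro conjI ballI)
  show "continuous_on {a'..b'} \<gamma>"
    using assms unfolding C1_curve_on_def by (blast intro: continuous_on_subset)
  fix c assume "c \<in> A"
  then obtain D where D: "continuous_on {s \<in> {a..b}. \<gamma> s \<in> cdom c} D"
    "\<And>s. s \<in> {a..b} \<Longrightarrow> \<gamma> s \<in> cdom c \<Longrightarrow>
      ((cmap c \<circ> \<gamma>) has_vector_derivative D s) (at s within {a..b})"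
    using assms(1) unfolding C1_curve_on_def by blast
  show "\<exists>D. continuous_on {s \<in> {a'..b'}. \<gamma> s \<in> cdom c} D \<and>
     (\<forall>s\<in>{a'..b'}. \<gamma> s \<in> cdom c \<longrightarrow>
       ((cmap c \<circ> \<gamma>) has_vector_derivative D s) (at s within {a'..b'}))"
  proof (intro exI[of _ D] conjI ballI impI)
    show "continuous_on {s \<in> {a'..b'}. \<gamma> s \<in> cdom c} D"
      by (rule continuous_on_subset[OF D(1)]) (use assms(2) in blast)
    show "((cmap c \<circ> \<gamma>) has_vector_derivative D s) (at s within {a'..b'})"
      if "s \<in> {a'..b'}" "\<gamma> s \<in> cdom c" for s
      by (rule has_vector_derivative_within_subset[OF D(2)]) (use that assms(2) in blast)+
  qed
qed

lemma C1_curve_on_cong: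
  assumes "C1_curve_on A \<gamma> a b" "\<And>s. s \<in> {a..b} \<Longrightarrow> \<gamma>' s = \<gamma> s"
  shows "C1_curve_on A \<gamma>' a b"
  unfolding C1_curve_on_def
proof (intro conjI ballI)
  show "continuous_on {a..b} \<gamma>'"
    by (rule continuous_on_eq[of _ \<gamma>]) (use assms in \<open>simp_all add: C1_curve_on_def\<close>)
  fix c assume "c \<in> A"
  then obtain D where D: "continuous_on {s \<in> {a..b}. \<gamma> s \<in> cdom c} D"
    "\<And>s. s \<in> {a..b} \<Longrightarrow> \<gamma> s \<in> cdom c \<Longrightarrow>
      ((cmap c \<circ> \<gamma>) has_vector_derivative D s) (at s within {a..b})"
    using assms(1) unfolding C1_curve_on_def by blast
  show "\<exists>D. continuous_on {s \<in> {a..b}. \<gamma>' s \<in> cdom c} D \<and>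
     (\<forall>s\<in>{a..b}. \<gamma>' s \<in> cdom c \<longrightarrow>
       ((cmap c \<circ> \<gamma>') has_vector_derivative D s) (at s within {a..b}))"
  proof (intro exI[of _ D] conjI ballI impI)
    show "continuous_on {s \<in> {a..b}. \<gamma>' s \<in> cdom c} D"
      by (rule continuous_on_subset[OF D(1)]) (use assms(2) in auto)
    show "((cmap c \<circ> \<gamma>') has_vector_derivative D s) (at s within {a..b})"
      if "s \<in> {a..b}" "\<gamma>' s \<in> cdom c" for s
      by (rule has_vector_derivative_transform[OF that(1) _ D(2)]) (use that assms(2) in auto)
  qed
qed

lemma C1_curve_on_affine:
  assumes "C1_curve_on A \<gamma> a b" "\<And>s. s \<in> {a'..b'} \<Longrightarrow> m * s + k \<in> {a..b}"
  shows "C1_curve_on A (\<lambda>s. \<gamma> (m * s + k)) a' b'"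
  unfolding C1_curve_on_def
proof (intro conjI ballI)
  show "continuous_on {a'..b'} (\<lambda>s. \<gamma> (m * s + k))"
  proof (rule continuous_on_compose2[of "{a..b}" \<gamma> "{a'..b'}" "\<lambda>s. m * s + k"])
    show "continuous_on {a..b} \<gamma>" using assms(1) by (simp add: C1_curve_on_def)
    show "continuous_on {a'..b'} (\<lambda>s. m * s + k)" by (intro continuous_intros)
    show "(\<lambda>s. m * s + k) ` {a'..b'} \<subseteq> {a..b}" using assms(2) by blast
  qed
  fix c assume "c \<in> A"
  then obtain D where D: "continuous_on {s \<in> {a..b}. \<gamma> s \<in> cdom c} D"
    "\<And>s. s \<in> {a..b} \<Longrightarrow> \<gamma> s \<in> cdom c \<Longrightarrow>
      ((cmap c \<circ> \<gamma>) has_vector_derivative D s) (at s within {a..b})"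
    using assms(1) unfolding C1_curve_on_def by blast
  show "\<exists>D. continuous_on {s \<in> {a'..b'}. \<gamma> (m * s + k) \<in> cdom c} D \<and>
     (\<forall>s\<in>{a'..b'}. \<gamma> (m * s + k) \<in> cdom c \<longrightarrow>
       ((cmap c \<circ> (\<lambda>s. \<gamma> (m * s + k))) has_vector_derivative D s) (at s within {a'..b'}))"
  proof (intro exI[of _ "\<lambda>s. m *\<^sub>R D (m * s + k)"] conjI ballI impI)
    show "continuous_on {s \<in> {a'..b'}. \<gamma> (m * s + k) \<in> cdom c} (\<lambda>s. m *\<^sub>R D (m * s + k))"
      by (intro continuous_intros continuous_on_compose2[OF D(1)]) (use assms(2) in auto)
    show "((cmap c \<circ> (\<lambda>s. \<gamma> (m * s + k))) has_vector_derivative m *\<^sub>R D (m * s + k)) (at s within {a'..b'})"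
      if "s \<in> {a'..b'}" "\<gamma> (m * s + k) \<in> cdom c" for s
    proof -
      have "((\<lambda>s. m * s + k) has_vector_derivative m) (at s within {a'..b'})"
        by (auto intro!: derivative_eq_intros)
      moreover have "((cmap c \<circ> \<gamma>) has_vector_derivative D (m * s + k))
          (at (m * s + k) within (\<lambda>s. m * s + k) ` {a'..b'})"
        by (rule has_vector_derivative_within_subset[OF D(2)]) (use that assms(2) in auto)
      ultimately show ?thesis
        using vector_diff_chain_within[of "\<lambda>s. m * s + k" m s "{a'..b'}" "cmap c \<circ> \<gamma>"]
        by (simp add: o_def)
    qed
  qed
qed

text \<open>The inductive form replaces reasoning about sequences of break points by induction over
  the pieces, and the free parameter interval lets curves be cut and joined without rescaling to the
  unit interval each time.\<close>

inductive pw_C1 ::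
  "('m::topological_space, 'e::real_inner) chart set \<Rightarrow> (real \<Rightarrow> 'm) \<Rightarrow> real \<Rightarrow> real \<Rightarrow> bool"
  for A \<gamma> where
  single: "a < b \<Longrightarrow> C1_curve_on A \<gamma> a b \<Longrightarrow> pw_C1 A \<gamma> a b"
| append: "pw_C1 A \<gamma> a b \<Longrightarrow> b < c \<Longrightarrow> C1_curve_on A \<gamma> b c \<Longrightarrow> pw_C1 A \<gamma> a c"

lemma pw_C1_less: "pw_C1 A \<gamma> a b \<Longrightarrow> a < b"
  by (induction rule: pw_C1.induct) auto

lemma pw_C1_trans: "pw_C1 A \<gamma> b c \<Longrightarrow> pw_C1 A \<gamma> a b \<Longrightarrow> pw_C1 A \<gamma> a c"
  by (induction rule: pw_C1.induct) (auto intro: pw_C1.append)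

lemma piecewise_C1_curve_iff: "piecewise_C1_curve A \<gamma> \<longleftrightarrow> pw_C1 A \<gamma> 0 1"
proof
  assume "piecewise_C1_curve A \<gamma>"
  then obtain n and t :: "nat \<Rightarrow> real" where t: "t 0 = 0" "t n = 1"
    "\<And>i. i < n \<Longrightarrow> t i < t (Suc i) \<and> C1_curve_on A \<gamma> (t i) (t (Suc i))"
    unfolding piecewise_C1_curve_def by blast
  have "i < n \<Longrightarrow> pw_C1 A \<gamma> (t 0) (t (Suc i))" for i
    by (induction i) (use t(3) in \<open>auto intro: pw_C1.intros\<close>)
  moreover have "n \<noteq> 0" using t(1,2) by (intro notI) simp
  ultimately show "pw_C1 A \<gamma> 0 1" using t(1,2) by (metis lessI not0_implies_Suc)
next
  have "\<exists>(n::nat) t. t 0 = a \<and> t n = b \<and>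
     (\<forall>i<n. t i < t (Suc i) \<and> C1_curve_on A \<gamma> (t i) (t (Suc i)))" if "pw_C1 A \<gamma> a b" for a b
    using that
  proof induction
    case (single a b)
    then show ?case by (intro exI[of _ 1] exI[of _ "\<lambda>i. if i = 0 then a else b"]) auto
  next
    case (append a b c)
    then obtain n and t :: "nat \<Rightarrow> real" where t: "t 0 = a" "t n = b"
      "\<And>i. i < n \<Longrightarrow> t i < t (Suc i) \<and> C1_curve_on A \<gamma> (t i) (t (Suc i))"
      by blast
    then show ?case
      using append by (intro exI[of _ "Suc n"] exI[of _ "t(Suc n := c)"]) (auto simp: less_Suc_eq)
  qed
  moreover assume "pw_C1 A \<gamma> 0 1"
  ultimately show "piecewise_C1_curve A \<gamma>" unfolding piecewise_C1_curve_def by blast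
qed

lemma pw_C1_subinterval:
  "pw_C1 A \<gamma> a b \<Longrightarrow> a \<le> s \<Longrightarrow> s < t \<Longrightarrow> t \<le> b \<Longrightarrow> pw_C1 A \<gamma> s t"
proof (induction arbitrary: s t rule: pw_C1.induct)
  case (single a b)
  then show ?case by (auto intro!: pw_C1.single elim!: C1_curve_on_subset)
next
  case (append a b c)
  consider "t \<le> b" | "b \<le> s" | "s < b" "b < t" by linarith
  then show ?case
  proof cases
    case 1
    then show ?thesis using append by auto
  next
    case 2
    then show ?thesis using append by (auto intro!: pw_C1.single elim!: C1_curve_on_subset)
  next
    case 3
    then have "pw_C1 A \<gamma> s b" using append by auto
    then show ?thesis
      by (rule pw_C1.append) (use 3 append in \<open>auto elim!: C1_curve_on_subset\<close>)
  qed
qed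

lemma pw_C1_cong:
  "pw_C1 A \<gamma> a b \<Longrightarrow> (\<And>s. s \<in> {a..b} \<Longrightarrow> \<gamma>' s = \<gamma> s) \<Longrightarrow> pw_C1 A \<gamma>' a b"
proof (induction rule: pw_C1.induct)
  case (single a b)
  then show ?case by (auto intro!: pw_C1.single elim!: C1_curve_on_cong)
next
  case (append a b c)
  then have "a < b" using pw_C1_less by blast
  then have "pw_C1 A \<gamma>' a b" using append by auto
  then show ?case
    by (rule pw_C1.append) (use append \<open>a < b\<close> in \<open>auto elim!: C1_curve_on_cong\<close>)
qed

lemma pw_C1_affine:
  assumes "pw_C1 A \<gamma> a b" "0 < m"
  shows "pw_C1 A (\<lambda>s. \<gamma> (m * s + k)) ((a - k) / m) ((b - k) / m)"
  using assms
proof (induction rule: pw_C1.induct)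
  case (single a b)
  have "C1_curve_on A (\<lambda>s. \<gamma> (m * s + k)) ((a - k) / m) ((b - k) / m)"
    by (rule C1_curve_on_affine[OF single(2)]) (use assms in \<open>auto simp: field_simps\<close>)
  then show ?case
    using single by (intro pw_C1.single) (auto intro!: divide_strict_right_mono)
next
  case (append a b c)
  have C: "C1_curve_on A (\<lambda>s. \<gamma> (m * s + k)) ((b - k) / m) ((c - k) / m)"
    by (rule C1_curve_on_affine[OF append(3)]) (use assms in \<open>auto simp: field_simps\<close>)
  from append have "pw_C1 A (\<lambda>s. \<gamma> (m * s + k)) ((a - k) / m) ((b - k) / m)" by blast
  then show ?case
    by (rule pw_C1.append) (use append C in \<open>auto intro!: divide_strict_right_mono\<close>)
qed

lemma pw_C1_reverse:
  assumes "pw_C1 A \<gamma> a b"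
  shows "pw_C1 A (\<lambda>s. \<gamma> (- s)) (- b) (- a)"
  using assms
proof (induction rule: pw_C1.induct)
  case (single a b)
  then show ?case
    using C1_curve_on_affine[of A \<gamma> a b "- b" "- a" "-1" 0] by (auto intro!: pw_C1.single)
next
  case (append a b c)
  have "pw_C1 A (\<lambda>s. \<gamma> (- s)) (- c) (- b)"
    using append C1_curve_on_affine[of A \<gamma> b c "- c" "- b" "-1" 0] by (auto intro!: pw_C1.single)
  with append(4) show ?case by (rule pw_C1_trans)
qed

text \<open>\<open>velocity\<close> is a two-sided derivative with an arbitrary value where that
  fails to exist. This predicate singles out the parameters where it is genuine in every chart.
  Continuity is included so that nearby points stay in a chart domain and chart expressions can be
  compared.\<close>

definition regular_at ::
  "('m::topological_space, 'e::real_inner) chart set \<Rightarrow> (real \<Rightarrow> 'm) \<Rightarrow> real \<Rightarrow> bool" where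
  "regular_at A \<gamma> s \<longleftrightarrow> isCont \<gamma> s \<and> (\<forall>c\<in>A. \<gamma> s \<in> cdom c \<longrightarrow>
     ((cmap c \<circ> \<gamma>) has_vector_derivative velocity A \<gamma> s c) (at s))"

lemma C1_curve_on_regular:
  assumes "C1_curve_on A \<gamma> a b" "s \<in> {a<..<b}"
  shows "regular_at A \<gamma> s"
proof -
  have at: "at s within {a..b} = at s"
    by (rule at_within_interior) (use assms in simp)
  have "isCont \<gamma> s"
    by (rule continuous_on_interior[of "{a..b}"]) (use assms in \<open>auto simp: C1_curve_on_def\<close>)
  moreover have "((cmap c \<circ> \<gamma>) has_vector_derivative velocity A \<gamma> s c) (at s)"
    if c: "c \<in> A" "\<gamma> s \<in> cdom c" for c
  proof -
    obtain D where "((cmap c \<circ> \<gamma>) has_vector_derivative D) (at s within {a..b})"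
      using assms c unfolding C1_curve_on_def by fastforce
    then have "((cmap c \<circ> \<gamma>) has_vector_derivative D) (at s)" by (simp add: at)
    then show ?thesis
      using vector_derivative_at[of "cmap c \<circ> \<gamma>" D s] c by (simp add: velocity_def)
  qed
  ultimately show ?thesis unfolding regular_at_def by blast
qed

text \<open>\<open>S\<close> collects the end points and break points; integrals of the speed do not
  see this finite set.\<close>

lemma pw_C1_regular:
  assumes "pw_C1 A \<gamma> a b"
  obtains S where "finite S" "\<And>s. s \<in> {a..b} - S \<Longrightarrow> regular_at A \<gamma> s"
proof -
  have "\<exists>S. finite S \<and> (\<forall>s\<in>{a..b} - S. regular_at A \<gamma> s)"
    using assms
  proof induction
    case (single a b)
    have "regular_at A \<gamma> s" if "s \<in> {a..b} - {a, b}" for s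
      by (rule C1_curve_on_regular[OF single(2)]) (use that in auto)
    then show ?case by (intro exI[of _ "{a, b}"]) blast
  next
    case (append a b c)
    then obtain S where S: "finite S" "\<And>s. s \<in> {a..b} - S \<Longrightarrow> regular_at A \<gamma> s" by blast
    have "regular_at A \<gamma> s" if s: "s \<in> {a..c} - (S \<union> {b, c})" for s
    proof (cases "s \<le> b")
      case True
      then show ?thesis using S(2)[of s] s by auto
    next
      case False
      then show ?thesis using C1_curve_on_regular[OF append(3)] s by auto
    qed
    then show ?case using S(1) by (intro exI[of _ "S \<union> {b, c}"]) blast
  qed
  then show ?thesis using that by blast
qed

lemma pw_C1_continuous: "pw_C1 A \<gamma> a b \<Longrightarrow> continuous_on {a..b} \<gamma>"
proof (induction rule: pw_C1.induct)
  case (single a b)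
  then show ?case by (simp add: C1_curve_on_def)
next
  case (append a b c)
  have "continuous_on ({a..b} \<union> {b..c}) \<gamma>"
    using append by (intro continuous_on_closed_Un) (auto simp: C1_curve_on_def)
  moreover have "{a..b} \<union> {b..c} = {a..c}"
    using append pw_C1_less[OF append(1)] by (intro ivl_disj_un_two_touch) auto
  ultimately show ?case by simp
qed

lemma velocity_cong:
  fixes A :: "('a, 'b::real_inner) chart set"
  assumes "\<forall>\<^sub>F t in nhds s. \<gamma> t = \<gamma>' t"
  shows "velocity A \<gamma> s = velocity A \<gamma>' s"
proof
  fix c :: "('a, 'b) chart"
  have "\<gamma> s = \<gamma>' s" using assms eventually_nhds_x_imp_x by blast
  moreover have "vector_derivative (cmap c \<circ> \<gamma>) (at s) = vector_derivative (cmap c \<circ> \<gamma>') (at s)"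
    by (rule vector_derivative_cong_eq) (use assms in \<open>auto elim: eventually_mono\<close>)
  ultimately show "velocity A \<gamma> s c = velocity A \<gamma>' s c" by (simp add: velocity_def)
qed

lemma velocity_affine:
  fixes A :: "('a::topological_space, 'b::real_inner) chart set"
  assumes "regular_at A \<gamma> (m * s + k)"
  shows "velocity A (\<lambda>s. \<gamma> (m * s + k)) s = (\<lambda>c. m *\<^sub>R velocity A \<gamma> (m * s + k) c)"
proof
  fix c :: "('a, 'b) chart"
  show "velocity A (\<lambda>s. \<gamma> (m * s + k)) s c = m *\<^sub>R velocity A \<gamma> (m * s + k) c"
  proof (cases "c \<in> A \<and> \<gamma> (m * s + k) \<in> cdom c")
    case True
    have "((\<lambda>s. m * s + k) has_vector_derivative m) (at s)"
      by (auto intro!: derivative_eq_intros)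
    moreover have "((cmap c \<circ> \<gamma>) has_vector_derivative velocity A \<gamma> (m * s + k) c) (at (m * s + k))"
      using assms True unfolding regular_at_def by blast
    ultimately have "((cmap c \<circ> (\<lambda>s. \<gamma> (m * s + k))) has_vector_derivative
        m *\<^sub>R velocity A \<gamma> (m * s + k) c) (at s)"
      using vector_diff_chain_at[of "\<lambda>s. m * s + k" m s "cmap c \<circ> \<gamma>"] by (simp add: o_def)
    from vector_derivative_at[OF this] True show ?thesis
      unfolding velocity_def[of A "\<lambda>s. \<gamma> (m * s + k)"] by simp
  next
    case False
    then show ?thesis by (auto simp: velocity_def)
  qed
qed

section \<open>Length of curves\<close>

context riemannian_manifold
begin

text \<open>Near \<open>s\<close> the curve in chart \<open>c'\<close> is the transition map applied
  to the curve in chart \<open>c\<close>; the chain rule then gives exactly the compatibility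
  demanded of a tangent vector.\<close>

lemma velocity_tangent:
  assumes "regular_at A \<gamma> s"
  shows "velocity A \<gamma> s \<in> tangent_space A (\<gamma> s)"
proof -
  have "velocity A \<gamma> s c' = dtr c c' (\<gamma> s) (velocity A \<gamma> s c)"
    if c: "c \<in> A" "c' \<in> A" "\<gamma> s \<in> cdom c" "\<gamma> s \<in> cdom c'" for c c'
  proof -
    have V: "((cmap d \<circ> \<gamma>) has_vector_derivative velocity A \<gamma> s d) (at s)"
      if "d \<in> A" "\<gamma> s \<in> cdom d" for d
      using assms that unfolding regular_at_def by blast
    have "((cmap c' \<circ> cinv c) has_derivative dtr c c' (\<gamma> s)) (at ((cmap c \<circ> \<gamma>) s) within range (cmap c \<circ> \<gamma>))"
      using transition_has_derivative[OF c] by (simp add: has_derivative_at_withinI)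
    then have 1: "(((cmap c' \<circ> cinv c) \<circ> (cmap c \<circ> \<gamma>)) has_vector_derivative dtr c c' (\<gamma> s) (velocity A \<gamma> s c)) (at s)"
      by (rule vector_derivative_diff_chain_within[OF V[OF c(1,3)]])
    have "\<forall>\<^sub>F t in at s. \<gamma> t \<in> cdom c"
      using assms open_cdom[OF c(1)] c(3) unfolding regular_at_def isCont_def
      by (blast intro: topological_tendstoD)
    then have ev: "\<forall>\<^sub>F t in nhds s. \<gamma> t \<in> cdom c"
      using c(3) by (simp add: eventually_nhds_conv_at)
    have "((cmap c' \<circ> \<gamma>) has_vector_derivative dtr c c' (\<gamma> s) (velocity A \<gamma> s c)) (at s)"
    proof (rule has_vector_derivative_cong_ev[THEN iffD1, OF _ _ 1])
      show "\<forall>\<^sub>F t in nhds s. t \<in> UNIV \<longrightarrow> (cmap c' \<circ> cinv c \<circ> (cmap c \<circ> \<gamma>)) t = (cmap c' \<circ> \<gamma>) t"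
        by (rule eventually_mono[OF ev]) (simp add: cinv_cmap[OF c(1)])
      show "(cmap c' \<circ> cinv c \<circ> (cmap c \<circ> \<gamma>)) s = (cmap c' \<circ> \<gamma>) s"
        by (simp add: cinv_cmap c)
    qed
    then show ?thesis
      using V[OF c(2,4)] vector_derivative_unique_at by blast
  qed
  moreover have "velocity A \<gamma> s c = 0" if "\<not> (c \<in> A \<and> \<gamma> s \<in> cdom c)" for c
    using that unfolding velocity_def by presburger
  ultimately show ?thesis unfolding tangent_space_def by blast
qed

definition speed :: "(real \<Rightarrow> 'm) \<Rightarrow> real \<Rightarrow> real" where
  "speed \<gamma> s = tnorm g (\<gamma> s) (velocity A \<gamma> s)"

definition len :: "(real \<Rightarrow> 'm) \<Rightarrow> real \<Rightarrow> real \<Rightarrow> real" where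
  "len \<gamma> a b = integral {a..b} (speed \<gamma>)"

lemma curve_length_eq_len: "curve_length A g \<gamma> = len \<gamma> 0 1"
  by (simp add: curve_length_def len_def speed_def[abs_def])

lemma speed_chart:
  assumes "regular_at A \<gamma> s" "c \<in> A" "\<gamma> s \<in> cdom c"
  shows "speed \<gamma> s = sqrt (chart_metric c (cmap c (\<gamma> s)) (velocity A \<gamma> s c) (velocity A \<gamma> s c))"
  unfolding speed_def by (rule tnorm_chart[OF assms(2,3) velocity_tangent[OF assms(1)]])

lemma tnorm_nonneg:
  assumes "v \<in> tangent_space A p"
  shows "0 \<le> tnorm g p v"
proof -
  obtain c where c: "c \<in> A" "p \<in> cdom c" by (rule chart_at)
  show ?thesis
    using tnorm_chart[OF c assms] inner_form.nonneg[OF inner_form_chart_metric[OF c(1)], of "cmap c p" "v c"] c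
    by simp
qed

lemma tnorm_scale:
  assumes "v \<in> tangent_space A p"
  shows "tnorm g p (\<lambda>c. r *\<^sub>R v c) = \<bar>r\<bar> * tnorm g p v"
proof -
  obtain c where c: "c \<in> A" "p \<in> cdom c" by (rule chart_at)
  have v: "v = coord_vec A c p (v c)" by (rule tangent_eq_coord_vec[OF c assms])
  interpret inner_form "chart_metric c (cmap c p)" by (rule inner_form_chart_metric) (use c in auto)
  have "(\<lambda>c. r *\<^sub>R v c) = coord_vec A c p (r *\<^sub>R v c)"
    using coord_vec_scale[OF c, of r "v c"] v by metis
  then have "(\<lambda>c. r *\<^sub>R v c) \<in> tangent_space A p"
    using coord_vec_tangent[OF c] by metis
  from tnorm_chart[OF c this] tnorm_chart[OF c assms] show ?thesis
    by (simp add: scale_left scale_right real_sqrt_mult flip: mult.assoc)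
qed

lemma speed_nonneg: "regular_at A \<gamma> s \<Longrightarrow> 0 \<le> speed \<gamma> s"
  unfolding speed_def by (rule tnorm_nonneg[OF velocity_tangent])

text \<open>Integrability on an interval is a local matter, so each parameter can be treated in one
  chart around its point. There the speed equals a continuous function built from \<open>D\<close>,
  except possibly at \<open>a\<close> and \<open>b\<close>, where only one-sided derivatives are
  controlled.\<close>

lemma C1_speed_integrable:
  assumes "C1_curve_on A \<gamma> a b"
  shows "speed \<gamma> integrable_on {a..b}"
proof -
  have cont: "continuous_on {a..b} \<gamma>" using assms by (simp add: C1_curve_on_def)
  have "speed \<gamma> integrable_on cbox a b"
  proof (rule integrable_on_little_subintervals, rule ballI)
    fix s assume "s \<in> cbox a b"
    then have s: "s \<in> {a..b}" by simp
    obtain c where c: "c \<in> A" "\<gamma> s \<in> cdom c" by (rule chart_at)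
    obtain D where D: "continuous_on {s \<in> {a..b}. \<gamma> s \<in> cdom c} D"
      "\<And>s. s \<in> {a..b} \<Longrightarrow> \<gamma> s \<in> cdom c \<Longrightarrow>
        ((cmap c \<circ> \<gamma>) has_vector_derivative D s) (at s within {a..b})"
      using assms c unfolding C1_curve_on_def by blast
    obtain W where W: "open W" "s \<in> W" "\<And>t. t \<in> {a..b} \<Longrightarrow> t \<in> W \<Longrightarrow> \<gamma> t \<in> cdom c"
      using cont s open_cdom[OF c(1)] c(2) unfolding continuous_on_topological by metis
    obtain d where d: "d > 0" "ball s d \<subseteq> W" using W open_contains_ball by blast
    have "speed \<gamma> integrable_on cbox u v"
      if uv: "s \<in> cbox u v" "cbox u v \<subseteq> ball s d" "cbox u v \<subseteq> cbox a b" for u v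
    proof -
      have sub: "t \<in> {a..b}" "\<gamma> t \<in> cdom c" if "t \<in> {u..v}" for t
        using that uv(2,3) d(2) W(3)[of t] by (auto simp: subset_iff)
      let ?h = "\<lambda>t. sqrt (chart_metric c (cmap c (\<gamma> t)) (D t) (D t))"
      have "continuous_on {u..v} (\<lambda>t. cmap c (\<gamma> t))"
        by (rule continuous_on_compose2[OF continuous_cmap[OF c(1)] continuous_on_subset[OF cont]])
          (use sub in auto)
      moreover have "continuous_on {u..v} D"
        by (rule continuous_on_subset[OF D(1)]) (use sub in auto)
      ultimately have "continuous_on {u..v} ?h"
        using sub by (intro continuous_on_real_sqrt continuous_on_chart_metric[OF c(1)]) auto
      then have "?h integrable_on {u..v}" by (rule integrable_continuous_interval)
      moreover have "speed \<gamma> t = ?h t" if t: "t \<in> {u..v} - {a, b}" for t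
      proof -
        have t': "t \<in> {a<..<b}" "t \<in> {a..b}" "\<gamma> t \<in> cdom c" using sub[of t] t by auto
        have "at t within {a..b} = at t"
          by (rule at_within_interior) (use t' in simp)
        then have "((cmap c \<circ> \<gamma>) has_vector_derivative D t) (at t)" using D(2)[of t] t' by simp
        then have "velocity A \<gamma> t c = D t"
          using vector_derivative_at c(1) t'(3) unfolding velocity_def by auto
        then show ?thesis
          using speed_chart[OF C1_curve_on_regular[OF assms t'(1)] c(1) t'(3)] by simp
      qed
      ultimately have "speed \<gamma> integrable_on {u..v}"
        by (intro integrable_spike_finite[of "{a, b}" "{u..v}" "speed \<gamma>" ?h]) auto
      then show ?thesis by simp
    qed
    then show "\<exists>d>0. \<forall>u v. s \<in> cbox u v \<and> cbox u v \<subseteq> ball s d \<and> cbox u v \<subseteq> cbox a b \<longrightarrow>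
      speed \<gamma> integrable_on cbox u v"
      using d(1) by blast
  qed
  then show ?thesis by simp
qed

lemma speed_integrable: "pw_C1 A \<gamma> a b \<Longrightarrow> speed \<gamma> integrable_on {a..b}"
proof (induction rule: pw_C1.induct)
  case (single a b)
  then show ?case by (blast intro: C1_speed_integrable)
next
  case (append a b c)
  then show ?case
    using pw_C1_less[OF append(1)] C1_speed_integrable[OF append(3)]
    by (intro Henstock_Kurzweil_Integration.integrable_combine[of a b c]) auto
qed

lemma len_nonneg:
  assumes "pw_C1 A \<gamma> a b"
  shows "0 \<le> len \<gamma> a b"
proof -
  obtain S where S: "finite S" "\<And>s. s \<in> {a..b} - S \<Longrightarrow> regular_at A \<gamma> s"
    using pw_C1_regular[OF assms] by blast
  \<comment> \<open>At irregular parameters \<open>velocity\<close> need not be tangent, and nothing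
    keeps \<open>g\<close> from being negative on it; the integrand is changed to 0 there.\<close>
  let ?f = "\<lambda>s. if s \<in> S then 0 else speed \<gamma> s"
  have "(speed \<gamma> has_integral len \<gamma> a b) {a..b}"
    unfolding len_def using speed_integrable[OF assms] by blast
  then have "(?f has_integral len \<gamma> a b) {a..b}"
    by (rule has_integral_spike_finite[OF S(1), rotated]) simp
  then show ?thesis
    by (rule has_integral_nonneg) (use S speed_nonneg in auto)
qed

lemma len_split:
  assumes "pw_C1 A \<gamma> a b" "a \<le> s" "s \<le> b"
  shows "len \<gamma> a b = len \<gamma> a s + len \<gamma> s b"
  unfolding len_def
  using Henstock_Kurzweil_Integration.integral_combine[OF assms(2,3) speed_integrable[OF assms(1)]] by simp

lemma len_mono:
  assumes "pw_C1 A \<gamma> a b" "a \<le> s" "s \<le> b"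
  shows "len \<gamma> a s \<le> len \<gamma> a b"
proof -
  have "0 \<le> len \<gamma> s b"
    using len_nonneg[OF pw_C1_subinterval[OF assms(1,2) _ order_refl]] assms(3)
    by (cases "s = b") (auto simp: len_def)
  then show ?thesis using len_split[OF assms] by simp
qed

text \<open>The velocity at an end point depends on the curve beyond the interval, so the end points
  are discarded as a negligible set and the curves are compared near interior parameters.\<close>

lemma len_cong:
  assumes "\<And>s. s \<in> {a<..<b} \<Longrightarrow> \<gamma>' s = \<gamma> s"
  shows "len \<gamma>' a b = len \<gamma> a b"
  unfolding len_def
proof (rule integral_spike[of "{a, b}"])
  fix s assume "s \<in> {a..b} - {a, b}"
  then have s: "s \<in> {a<..<b}" by auto
  then have "\<forall>\<^sub>F t in nhds s. t \<in> {a<..<b}" by (intro eventually_nhds_in_open) auto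
  then have "\<forall>\<^sub>F t in nhds s. \<gamma>' t = \<gamma> t" by (rule eventually_mono) (rule assms)
  from velocity_cong[OF this, of A] show "speed \<gamma> s = speed \<gamma>' s"
    using assms[OF s] by (simp add: speed_def)
qed simp

lemma speed_affine:
  assumes "regular_at A \<gamma> (m * s + k)"
  shows "speed (\<lambda>s. \<gamma> (m * s + k)) s = \<bar>m\<bar> * speed \<gamma> (m * s + k)"
  unfolding speed_def velocity_affine[OF assms] by (rule tnorm_scale[OF velocity_tangent[OF assms]])

lemma len_affine:
  assumes "pw_C1 A \<gamma> a b" "0 < m"
  shows "len (\<lambda>s. \<gamma> (m * s + k)) ((a - k) / m) ((b - k) / m) = len \<gamma> a b"
proof -
  obtain S where S: "finite S" "\<And>s. s \<in> {a..b} - S \<Longrightarrow> regular_at A \<gamma> s"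
    using pw_C1_regular[OF assms(1)] by blast
  have "(speed \<gamma> has_integral len \<gamma> a b) (cbox a b)"
    unfolding len_def using speed_integrable[OF assms(1)] by auto
  from has_integral_mult_right[OF has_integral_affinity'[OF this assms(2), of k], of m]
  have "((\<lambda>s. m * speed \<gamma> (m * s + k)) has_integral len \<gamma> a b) {(a - k) / m..(b - k) / m}"
    using assms(2) by (simp add: divide_inverse_commute flip: mult.assoc)
  then have "(speed (\<lambda>s. \<gamma> (m * s + k)) has_integral len \<gamma> a b) {(a - k) / m..(b - k) / m}"
  proof (rule has_integral_spike_finite[rotated 2])
    show "finite ((\<lambda>s. (s - k) / m) ` S)" using S by simp
    fix s assume s: "s \<in> {(a - k) / m..(b - k) / m} - (\<lambda>s. (s - k) / m) ` S"
    have "m * s + k \<notin> S"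
    proof
      assume "m * s + k \<in> S"
      then have "(m * s + k - k) / m \<in> (\<lambda>s. (s - k) / m) ` S" by blast
      then show False using s assms(2) by simp
    qed
    moreover have "m * s + k \<in> {a..b}" using s assms(2) by (auto simp: field_simps)
    ultimately show "speed (\<lambda>s. \<gamma> (m * s + k)) s = m * speed \<gamma> (m * s + k)"
      using speed_affine[of \<gamma> m s k] S(2) assms(2) by simp
  qed
  then show ?thesis unfolding len_def by (rule integral_unique)
qed

lemma len_reverse:
  assumes "pw_C1 A \<gamma> a b"
  shows "len (\<lambda>s. \<gamma> (- s)) (- b) (- a) = len \<gamma> a b"
proof -
  obtain S where S: "finite S" "\<And>s. s \<in> {a..b} - S \<Longrightarrow> regular_at A \<gamma> s"
    using pw_C1_regular[OF assms(1)] by blast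
  have "len (\<lambda>s. \<gamma> (- s)) (- b) (- a) = integral {- b..- a} (\<lambda>s. speed \<gamma> (- s))"
    unfolding len_def
  proof (rule integral_spike[of "uminus ` S"])
    show "negligible (uminus ` S)" using S by (intro negligible_finite) simp
    fix s assume s: "s \<in> {- b..- a} - uminus ` S"
    then have "- s \<notin> S" by force
    then show "speed \<gamma> (- s) = speed (\<lambda>s. \<gamma> (- s)) s"
      using speed_affine[of \<gamma> "-1" s 0] S(2)[of "- s"] s by auto
  qed
  then show ?thesis unfolding len_def by (simp add: Henstock_Kurzweil_Integration.integral_reflect_real)
qed

lemma pw_C1_concat:
  assumes 1: "pw_C1 A \<gamma> a b" and 2: "pw_C1 A \<delta> a' b'" and eq: "\<gamma> b = \<delta> a'"
  obtains \<eta> c where "pw_C1 A \<eta> a c" "\<eta> a = \<gamma> a" "\<eta> c = \<delta> b'" "len \<eta> a c = len \<gamma> a b + len \<delta> a' b'"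
proof -
  \<comment> \<open>The second curve is shifted to start at \<open>b\<close>. The factor 1 brings it
    into the form \<open>m * s + k\<close> of the affine lemmas. At \<open>s = b\<close> both
    branches agree by \<open>eq\<close>, so each closed piece may include the joint.\<close>
  define \<eta> where "\<eta> s = (if s \<le> b then \<gamma> s else \<delta> (1 * s + (a' - b)))" for s
  define c where "c = b' - (a' - b)"
  have lt: "a < b" "b < c" using pw_C1_less[OF 1] pw_C1_less[OF 2] by (auto simp: c_def)
  have e1: "\<eta> s = \<gamma> s" if "s \<in> {a..b}" for s using that by (simp add: \<eta>_def)
  have e2: "\<eta> s = \<delta> (1 * s + (a' - b))" if "s \<in> {b..c}" for s
    using that eq by (cases "s = b") (auto simp: \<eta>_def)
  have p: "pw_C1 A (\<lambda>s. \<delta> (1 * s + (a' - b))) b c"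
    using pw_C1_affine[OF 2, of 1 "a' - b"] by (simp add: c_def)
  have P: "pw_C1 A \<eta> a c"
    by (rule pw_C1_trans[OF pw_C1_cong[OF p e2] pw_C1_cong[OF 1 e1]])
  have "len \<eta> a b = len \<gamma> a b" by (rule len_cong) (use e1 in auto)
  moreover have "len \<eta> b c = len (\<lambda>s. \<delta> (1 * s + (a' - b))) b c" by (rule len_cong) (use e2 in auto)
  moreover have "\<dots> = len \<delta> a' b'"
    using len_affine[OF 2, of 1 "a' - b"] by (simp add: c_def)
  ultimately have "len \<eta> a c = len \<gamma> a b + len \<delta> a' b'"
    using len_split[OF P, of b] lt by simp
  then show ?thesis using that[OF P] e1[of a] e2[of c] lt by (simp add: c_def)
qed

text \<open>Every curve that is not made from given ones is a chart segment. In \<open>c\<close> its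
  velocity is the constant \<open>a\<close>; in another chart it is the transition differential at
  the moving point applied to \<open>a\<close>, which is continuous because transition maps are
  C1.\<close>

lemma segment:
  assumes c: "c \<in> A" and h: "0 < h" and im: "\<And>t. t \<in> {0..h} \<Longrightarrow> z + t *\<^sub>R a \<in> cmap c ` cdom c"
  defines "\<gamma> \<equiv> \<lambda>t. cinv c (z + t *\<^sub>R a)"
  shows segment_C1: "C1_curve_on A \<gamma> 0 h"
    and segment_speed: "\<And>s. s \<in> {0<..<h} \<Longrightarrow> speed \<gamma> s = sqrt (chart_metric c (z + s *\<^sub>R a) a a)"
proof -
  have l: "((\<lambda>t. z + t *\<^sub>R a) has_vector_derivative a) (at s within S)" for s S
    by (auto intro!: derivative_eq_intros)
  have dom: "\<gamma> t \<in> cdom c" and eq: "cmap c (\<gamma> t) = z + t *\<^sub>R a" if "t \<in> {0..h}" for t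
    using im[OF that] unfolding \<gamma>_def by (auto simp: cinv_in cmap_cinv)
  show C1: "C1_curve_on A \<gamma> 0 h"
    unfolding C1_curve_on_def
  proof (intro conjI ballI)
    show "continuous_on {0..h} \<gamma>"
      unfolding \<gamma>_def
      by (rule continuous_on_compose2[OF continuous_cinv[OF c]]) (use im in \<open>auto intro!: continuous_intros\<close>)
    fix c' assume c': "c' \<in> A"
    let ?D = "\<lambda>t. frechet_derivative (cmap c' \<circ> cinv c) (at (z + t *\<^sub>R a)) a"
    show "\<exists>D. continuous_on {s \<in> {0..h}. \<gamma> s \<in> cdom c'} D \<and>
       (\<forall>s\<in>{0..h}. \<gamma> s \<in> cdom c' \<longrightarrow>
         ((cmap c' \<circ> \<gamma>) has_vector_derivative D s) (at s within {0..h}))"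
    proof (intro exI[of _ ?D] conjI ballI impI)
      have "z + t *\<^sub>R a \<in> cmap c ` (cdom c \<inter> cdom c')" if "t \<in> {0..h}" "\<gamma> t \<in> cdom c'" for t
        using dom[OF that(1)] eq[OF that(1)] that(2) by (metis IntI image_eqI)
      then show "continuous_on {s \<in> {0..h}. \<gamma> s \<in> cdom c'} ?D"
        by (intro continuous_on_compose2[OF transition_C1[OF c c'], of _ "\<lambda>t. z + t *\<^sub>R a"]) (auto intro!: continuous_intros)
      fix s assume s: "s \<in> {0..h}" "\<gamma> s \<in> cdom c'"
      have "((cmap c' \<circ> cinv c) has_derivative frechet_derivative (cmap c' \<circ> cinv c) (at (z + s *\<^sub>R a)))
          (at (z + s *\<^sub>R a) within (\<lambda>t. z + t *\<^sub>R a) ` {0..h})"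
        using transition_has_derivative[OF c c' dom[OF s(1)] s(2)] unfolding eq[OF s(1)]
        by (rule has_derivative_at_withinI)
      from vector_derivative_diff_chain_within[OF l this]
      show "((cmap c' \<circ> \<gamma>) has_vector_derivative ?D s) (at s within {0..h})"
        by (simp add: \<gamma>_def o_def)
    qed
  qed
  fix s assume s: "s \<in> {0<..<h}"
  then have s': "s \<in> {0..h}" by simp
  have reg: "regular_at A \<gamma> s" by (rule C1_curve_on_regular[OF C1 s])
  then have "((cmap c \<circ> \<gamma>) has_vector_derivative velocity A \<gamma> s c) (at s)"
    using c dom[OF s'] unfolding regular_at_def by blast
  then have "((\<lambda>t. z + t *\<^sub>R a) has_vector_derivative velocity A \<gamma> s c) (at s)"
    by (rule has_vector_derivative_transform_within_open[OF _ open_greaterThanLessThan s]) (use eq in auto)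
  then have "velocity A \<gamma> s c = a" using l vector_derivative_unique_at by blast
  with speed_chart[OF reg c dom[OF s']] show "speed \<gamma> s = sqrt (chart_metric c (z + s *\<^sub>R a) a a)"
    using eq[OF s'] by simp
qed

text \<open>Being joined by a piecewise C1 curve is an equivalence relation with open classes, since
  segments join a point to a whole chart ball; connectedness leaves one class. Hence the infimum in
  \<open>riem_dist\<close> is taken over a nonempty set.\<close>

lemma reachable: "\<exists>\<gamma> a b. pw_C1 A \<gamma> a b \<and> \<gamma> a = p \<and> \<gamma> b = q"
proof -
  define R where "R p q \<longleftrightarrow> (\<exists>\<gamma> a b. pw_C1 A \<gamma> a b \<and> \<gamma> a = p \<and> \<gamma> b = q)" for p q
  have sym: "R q p" if pq: "R p q" for p q
  proof -
    obtain \<gamma> a b where "pw_C1 A \<gamma> a b" "\<gamma> a = p" "\<gamma> b = q" using pq unfolding R_def by blast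
    then show ?thesis
      unfolding R_def using pw_C1_reverse[of A \<gamma> a b]
      by (intro exI[of _ "\<lambda>s. \<gamma> (- s)"] exI[of _ "- b"] exI[of _ "- a"]) simp
  qed
  have trans: "R p r" if pq: "R p q" and qr: "R q r" for p q r
  proof -
    obtain \<gamma> a b where 1: "pw_C1 A \<gamma> a b" "\<gamma> a = p" "\<gamma> b = q" using pq unfolding R_def by blast
    obtain \<delta> a' b' where 2: "pw_C1 A \<delta> a' b'" "\<delta> a' = q" "\<delta> b' = r" using qr unfolding R_def by blast
    from 1(3) 2(2) have "\<gamma> b = \<delta> a'" by simp
    then obtain \<eta> c where "pw_C1 A \<eta> a c" "\<eta> a = \<gamma> a" "\<eta> c = \<delta> b'"
      using pw_C1_concat[OF 1(1) 2(1)] by metis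
    then show ?thesis unfolding R_def using 1 2 by blast
  qed
  have local: "\<exists>W. open W \<and> p \<in> W \<and> (\<forall>q\<in>W. R p q)" for p
  proof -
    obtain c where c: "c \<in> A" "p \<in> cdom c" by (rule chart_at)
    obtain r where r: "r > 0" "cball (cmap c p) r \<subseteq> cmap c ` (cdom c \<inter> UNIV)"
      using ball_in_chart[OF c open_UNIV UNIV_I] by blast
    define W where "W = cinv c ` (cmap c ` cdom c \<inter> ball (cmap c p) r)"
    have "R p q" if q: "q \<in> W" for q
    proof -
      obtain y where y: "y \<in> cmap c ` cdom c" "y \<in> ball (cmap c p) r" "q = cinv c y"
        using q unfolding W_def by blast
      have "cmap c p + t *\<^sub>R (y - cmap c p) \<in> cmap c ` cdom c" if "t \<in> {0..1}" for t
      proof -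
        have "norm (t *\<^sub>R (y - cmap c p)) \<le> 1 * norm (y - cmap c p)"
          unfolding norm_scaleR using that by (intro mult_right_mono) auto
        then have "cmap c p + t *\<^sub>R (y - cmap c p) \<in> cball (cmap c p) r"
          using y(2) by (simp add: dist_norm norm_minus_commute)
        then show ?thesis using r(2) by auto
      qed
      from segment_C1[OF c(1) zero_less_one this]
      have "pw_C1 A (\<lambda>t. cinv c (cmap c p + t *\<^sub>R (y - cmap c p))) 0 1"
        by (intro pw_C1.single) simp_all
      then show ?thesis
        unfolding R_def using y(3) c
        by (intro exI[of _ "\<lambda>t. cinv c (cmap c p + t *\<^sub>R (y - cmap c p))"] exI[of _ 0] exI[of _ 1])
          (simp add: cinv_cmap)
    qed
    moreover have "p \<in> W"
      using r(1) c cinv_cmap[OF c] unfolding W_def by (intro image_eqI[of _ _ "cmap c p"]) auto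
    ultimately show ?thesis using open_cinv_image[OF c(1) open_ball] unfolding W_def by blast
  qed
  have "open {q. R p q}"
  proof (subst open_subopen, rule ballI)
    fix q assume q: "q \<in> {q. R p q}"
    obtain W where W: "open W" "q \<in> W" "\<And>r. r \<in> W \<Longrightarrow> R q r" using local[of q] by blast
    have "W \<subseteq> {q. R p q}" using W(3) trans[of p q] q by auto
    with W(1,2) show "\<exists>T. open T \<and> q \<in> T \<and> T \<subseteq> {q. R p q}" by blast
  qed
  moreover have "open {q. \<not> R p q}"
  proof (subst open_subopen, rule ballI)
    fix q assume q: "q \<in> {q. \<not> R p q}"
    obtain W where W: "open W" "q \<in> W" "\<And>r. r \<in> W \<Longrightarrow> R q r" using local[of q] by blast
    have "W \<subseteq> {q. \<not> R p q}"
    proof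
      fix r assume "r \<in> W"
      then have "R r q" using W(3) sym by simp
      then show "r \<in> {q. \<not> R p q}" using trans[of p r q] q by auto
    qed
    with W(1,2) show "\<exists>T. open T \<and> q \<in> T \<and> T \<subseteq> {q. \<not> R p q}" by blast
  qed
  moreover have "R p p" using local by blast
  ultimately have "{q. \<not> R p q} \<inter> UNIV = {}"
    using connectedD[OF connected_space, of "{q. R p q}" "{q. \<not> R p q}"] by blast
  then show ?thesis unfolding R_def by blast
qed

end

section \<open>The Riemannian distance\<close>

context riemannian_manifold
begin

section \<open>The infimum of lengths and the metric axioms that follow from operations on
  curves\<close>

lemma curve_lengths_bdd_below:
  "bdd_below {curve_length A g \<gamma> | \<gamma>. piecewise_C1_curve A \<gamma> \<and> \<gamma> 0 = p \<and> \<gamma> 1 = q}"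
  by (rule bdd_belowI[of _ 0]) (auto simp: curve_length_eq_len piecewise_C1_curve_iff len_nonneg)

lemma riem_dist_le_len:
  assumes "pw_C1 A \<gamma> a b"
  shows "riem_dist A g (\<gamma> a) (\<gamma> b) \<le> len \<gamma> a b"
proof -
  let ?\<delta> = "\<lambda>s. \<gamma> ((b - a) * s + a)"
  have ab: "0 < b - a" using pw_C1_less[OF assms] by simp
  have "pw_C1 A ?\<delta> 0 1" "len ?\<delta> 0 1 = len \<gamma> a b"
    using pw_C1_affine[OF assms ab, of a] len_affine[OF assms ab, of a] ab by simp_all
  then have "len \<gamma> a b \<in> {curve_length A g \<eta> | \<eta>. piecewise_C1_curve A \<eta> \<and> \<eta> 0 = \<gamma> a \<and> \<eta> 1 = \<gamma> b}"
    by (auto simp: curve_length_eq_len piecewise_C1_curve_iff intro!: exI[of _ ?\<delta>])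
  then show ?thesis unfolding riem_dist_def by (rule cInf_lower[OF _ curve_lengths_bdd_below])
qed

lemma curve_lengths_nonempty:
  "{curve_length A g \<gamma> | \<gamma>. piecewise_C1_curve A \<gamma> \<and> \<gamma> 0 = p \<and> \<gamma> 1 = q} \<noteq> {}"
proof -
  obtain \<gamma> a b where \<gamma>: "pw_C1 A \<gamma> a b" "\<gamma> a = p" "\<gamma> b = q" using reachable by blast
  have ab: "0 < b - a" using pw_C1_less[OF \<gamma>(1)] by simp
  then have "pw_C1 A (\<lambda>s. \<gamma> ((b - a) * s + a)) 0 1"
    using pw_C1_affine[OF \<gamma>(1) ab, of a] by simp
  then show ?thesis
    using \<gamma> by (auto simp: piecewise_C1_curve_iff intro!: exI[of _ "\<lambda>s. \<gamma> ((b - a) * s + a)"])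
qed

lemma riem_dist_lessE:
  assumes "riem_dist A g p q < e"
  obtains \<gamma> where "pw_C1 A \<gamma> 0 1" "\<gamma> 0 = p" "\<gamma> 1 = q" "len \<gamma> 0 1 < e"
  using cInf_lessD[OF curve_lengths_nonempty assms[unfolded riem_dist_def]]
  by (auto simp: curve_length_eq_len piecewise_C1_curve_iff)

lemma riem_dist_nonneg: "0 \<le> riem_dist A g p q"
  unfolding riem_dist_def
  by (rule cInf_greatest[OF curve_lengths_nonempty])
    (auto simp: curve_length_eq_len piecewise_C1_curve_iff len_nonneg)

text \<open>The constant curve is written as the chart segment with direction 0, so that
  \<open>segment\<close> supplies both its regularity and its vanishing speed.\<close>

lemma riem_dist_self: "riem_dist A g p p = 0"
proof -
  obtain c where c: "c \<in> A" "p \<in> cdom c" by (rule chart_at)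
  let ?\<gamma> = "\<lambda>t::real. cinv c (cmap c p + t *\<^sub>R 0)"
  have im: "cmap c p + t *\<^sub>R 0 \<in> cmap c ` cdom c" if "t \<in> {0..1}" for t using c by simp
  have pw: "pw_C1 A ?\<gamma> 0 1"
    by (rule pw_C1.single[OF zero_less_one segment_C1[OF c(1) zero_less_one im]])
  interpret inner_form "chart_metric c (cmap c p)" by (rule inner_form_chart_metric) (use c in auto)
  have "len ?\<gamma> 0 1 = integral {0..1::real} (\<lambda>t. 0 :: real)"
    unfolding len_def
  proof (rule integral_spike[of "{0, 1}"])
    fix t :: real assume "t \<in> {0..1} - {0, 1}"
    then have "t \<in> {0<..<1}" by auto
    from segment_speed[OF c(1) zero_less_one im this] show "0 = speed ?\<gamma> t" by simp
  qed simp
  then have "riem_dist A g p p \<le> 0"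
    using riem_dist_le_len[OF pw] cinv_cmap[OF c] by simp
  then show ?thesis using riem_dist_nonneg[of p p] by simp
qed

lemma riem_dist_commute: "riem_dist A g p q = riem_dist A g q p"
proof -
  have "riem_dist A g q p \<le> riem_dist A g p q" for p q
  proof (rule ccontr)
    assume "\<not> riem_dist A g q p \<le> riem_dist A g p q"
    then have "riem_dist A g p q < riem_dist A g q p" by simp
    then obtain \<gamma> where \<gamma>: "pw_C1 A \<gamma> 0 1" "\<gamma> 0 = p" "\<gamma> 1 = q" "len \<gamma> 0 1 < riem_dist A g q p"
      by (rule riem_dist_lessE)
    from riem_dist_le_len[OF pw_C1_reverse[OF \<gamma>(1)]] len_reverse[OF \<gamma>(1)] \<gamma>(2-4)
    show False by simp
  qed
  then show ?thesis by (simp add: antisym)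
qed

lemma riem_dist_triangle: "riem_dist A g p r \<le> riem_dist A g p q + riem_dist A g q r"
proof (rule field_le_epsilon)
  fix e :: real assume e: "0 < e"
  obtain \<gamma> where 1: "pw_C1 A \<gamma> 0 1" "\<gamma> 0 = p" "\<gamma> 1 = q" "len \<gamma> 0 1 < riem_dist A g p q + e / 2"
    using riem_dist_lessE[of p q "riem_dist A g p q + e / 2"] e by auto
  obtain \<delta> where 2: "pw_C1 A \<delta> 0 1" "\<delta> 0 = q" "\<delta> 1 = r" "len \<delta> 0 1 < riem_dist A g q r + e / 2"
    using riem_dist_lessE[of q r "riem_dist A g q r + e / 2"] e by auto
  have "\<gamma> 1 = \<delta> 0" using 1 2 by simp
  then obtain \<eta> c where "pw_C1 A \<eta> 0 c" "\<eta> 0 = \<gamma> 0" "\<eta> c = \<delta> 1" "len \<eta> 0 c = len \<gamma> 0 1 + len \<delta> 0 1"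
    using pw_C1_concat[OF 1(1) 2(1)] by metis
  with riem_dist_le_len[of \<eta> 0 c] 1 2
  show "riem_dist A g p r \<le> riem_dist A g p q + riem_dist A g q r + e" by simp
qed

text \<open>The difference vector is paired with the curve itself, so that only a real-valued function
  has to be integrated.\<close>

lemma chart_displacement_le_len:
  assumes pw: "pw_C1 A \<gamma> a b" and c: "c \<in> A"
    and dom: "\<And>s. s \<in> {a..b} \<Longrightarrow> \<gamma> s \<in> cdom c"
    and k0: "0 \<le> k"
    and k: "\<And>s v. s \<in> {a..b} \<Longrightarrow> k * norm v \<le> sqrt (chart_metric c (cmap c (\<gamma> s)) v v)"
  shows "k * norm (cmap c (\<gamma> b) - cmap c (\<gamma> a)) \<le> len \<gamma> a b"
proof -
  define w where "w = cmap c (\<gamma> b) - cmap c (\<gamma> a)"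
  have ab: "a \<le> b" using pw_C1_less[OF pw] by simp
  obtain S where S: "finite S" "\<And>s. s \<in> {a..b} - S \<Longrightarrow> regular_at A \<gamma> s"
    using pw_C1_regular[OF pw] by blast
  let ?V = "\<lambda>s. inner (velocity A \<gamma> s c) w"
  have "(?V has_integral (inner (cmap c (\<gamma> b)) w - inner (cmap c (\<gamma> a)) w)) {a..b}"
  proof (rule fundamental_theorem_of_calculus_strong[OF S(1) ab])
    show "continuous_on {a..b} (\<lambda>s. inner (cmap c (\<gamma> s)) w)"
      by (intro continuous_intros continuous_on_compose2[OF continuous_cmap[OF c] pw_C1_continuous[OF pw]])
        (use dom in auto)
    fix s assume s: "s \<in> {a..b} - S"
    have "((cmap c \<circ> \<gamma>) has_vector_derivative velocity A \<gamma> s c) (at s)"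
      using S(2)[OF s] c dom[of s] s unfolding regular_at_def by blast
    from bounded_linear.has_vector_derivative[OF bounded_linear_inner_left this, of w]
    show "((\<lambda>s. inner (cmap c (\<gamma> s)) w) has_vector_derivative ?V s) (at s)" by (simp add: o_def)
  qed
  then have "((\<lambda>s. k * ?V s) has_integral k * (norm w)\<^sup>2) {a..b}"
    by (intro has_integral_mult_right) (simp add: w_def power2_norm_eq_inner flip: inner_diff_left)
  then have I1: "((\<lambda>s. if s \<in> S then 0 else k * ?V s) has_integral k * (norm w)\<^sup>2) {a..b}"
    by (rule has_integral_spike_finite[OF S(1), rotated]) simp
  have "((\<lambda>s. norm w * speed \<gamma> s) has_integral norm w * len \<gamma> a b) {a..b}"
    unfolding len_def using speed_integrable[OF pw] by (intro has_integral_mult_right integrable_integral)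
  then have I2: "((\<lambda>s. if s \<in> S then 0 else norm w * speed \<gamma> s) has_integral norm w * len \<gamma> a b) {a..b}"
    by (rule has_integral_spike_finite[OF S(1), rotated]) simp
  have "k * (norm w)\<^sup>2 \<le> norm w * len \<gamma> a b"
  proof (rule has_integral_le[OF I1 I2])
    fix s assume s: "s \<in> {a..b}"
    show "(if s \<in> S then 0 else k * ?V s) \<le> (if s \<in> S then 0 else norm w * speed \<gamma> s)"
    proof (cases "s \<in> S")
      case False
      then have "k * norm (velocity A \<gamma> s c) \<le> speed \<gamma> s"
        using speed_chart[OF S(2) c dom[OF s]] k[OF s] s by auto
      then have "norm w * (k * norm (velocity A \<gamma> s c)) \<le> norm w * speed \<gamma> s"
        by (intro mult_left_mono) auto
      moreover have "k * ?V s \<le> k * (norm (velocity A \<gamma> s c) * norm w)"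
        using k0 by (intro mult_left_mono norm_cauchy_schwarz)
      ultimately show ?thesis using False by (simp add: mult_ac)
    qed simp
  qed
  \<comment> \<open>For \<open>w = 0\<close> only nonnegativity of the length is left; otherwise one
    factor \<open>norm w\<close> cancels.\<close>
  then show ?thesis
    using len_nonneg[OF pw] unfolding w_def[symmetric]
    by (cases "w = 0") (auto simp: power2_eq_square mult.left_commute[of k])
qed

text \<open>A first-exit argument with \<open>e = k * r\<close>. A curve from \<open>p\<close>
  shorter than this would, at the moment of leaving the open set \<open>V\<close>, have moved by
  less than \<open>r\<close> in the chart and hence still be in \<open>V\<close>.\<close>

lemma riem_dist_refines:
  assumes "open U" "p \<in> U"
  obtains e where "e > 0" "\<And>q. riem_dist A g p q < e \<Longrightarrow> q \<in> U"
proof -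
  obtain c where c: "c \<in> A" "p \<in> cdom c" by (rule chart_at)
  let ?z = "cmap c p"
  obtain r where r: "r > 0" "cball ?z r \<subseteq> cmap c ` (cdom c \<inter> U)"
    using ball_in_chart[OF c assms] by blast
  then have rc: "cball ?z r \<subseteq> cmap c ` cdom c" by blast
  obtain k where k: "k > 0" "\<And>x a. x \<in> cball ?z r \<Longrightarrow> k * norm a \<le> sqrt (chart_metric c x a a)"
    using chart_metric_lower_bound[OF c(1) rc less_imp_le[OF r(1)]] by blast
  \<comment> \<open>\<open>V\<close> is open, so that there is a first parameter outside it;
    \<open>K\<close> is its closed counterpart, on which the bound \<open>k\<close> holds up to and
    including that parameter.\<close>
  define V where "V = cinv c ` (cmap c ` cdom c \<inter> ball ?z r)"
  define K where "K = cinv c ` cball ?z r"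
  have V: "open V" "p \<in> V" "V \<subseteq> K"
    unfolding V_def K_def
    using open_cinv_image[OF c(1) open_ball] r(1) c cinv_cmap[OF c]
    by (auto intro!: image_eqI[of p _ ?z])
  have VU: "V \<subseteq> U"
  proof
    fix q assume "q \<in> V"
    then obtain y where y: "y \<in> ball ?z r" "q = cinv c y" unfolding V_def by blast
    then obtain u where "y = cmap c u" "u \<in> cdom c \<inter> U" using r(2) by (force simp: subset_iff)
    then show "q \<in> U" using y(2) cinv_cmap[OF c(1)] by auto
  qed
  have VI: "q \<in> V" if "q \<in> cdom c" "cmap c q \<in> ball ?z r" for q
    unfolding V_def using that cinv_cmap[OF c(1), of q] by (intro image_eqI[of _ _ "cmap c q"]) auto
  have K: "q \<in> cdom c \<and> cmap c q \<in> cball ?z r" if "q \<in> K" for q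
  proof -
    obtain y where "y \<in> cball ?z r" "q = cinv c y" using \<open>q \<in> K\<close> unfolding K_def by blast
    moreover from this have "y \<in> cmap c ` cdom c" using rc by blast
    ultimately show ?thesis using cinv_in[of y c] cmap_cinv[of y c] by simp
  qed
  obtain B :: "'e set" where B: "finite B" "span B = UNIV" using finite_dimensional by blast
  have "compact K"
    unfolding K_def
    by (intro compact_continuous_image compact_cball_finite_span[OF B] continuous_on_subset[OF continuous_cinv[OF c(1)] rc])
  \<comment> \<open>The Hausdorff property enters here. The exit point is a limit of points of
    \<open>K\<close>, so it stays in \<open>K\<close> and thereby in the chart domain, where its
    coordinates can be measured.\<close>
  then have "closed K" by (rule compact_imp_closed)
  have "q \<in> V" if q: "riem_dist A g p q < k * r" for q
  proof (rule ccontr)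
    assume "q \<notin> V"
    obtain \<gamma> where \<gamma>: "pw_C1 A \<gamma> 0 1" "\<gamma> 0 = p" "\<gamma> 1 = q" "len \<gamma> 0 1 < k * r"
      using riem_dist_lessE[OF q] by blast
    have cont: "continuous_on {0..1} \<gamma>" by (rule pw_C1_continuous[OF \<gamma>(1)])
    \<comment> \<open>The parameters at which the curve is outside \<open>V\<close>. This set is
      compact because \<open>V\<close> is open; its least element \<open>T\<close> is the exit
      time.\<close>
    let ?C = "{0..1} \<inter> \<gamma> -` (- V)"
    have "closed ?C" using continuous_closed_preimage[OF cont] V(1) by auto
    then have "compact ({0..1} \<inter> ?C)" by (intro compact_Int_closed) auto
    then have "compact ?C" by (simp add: Int_assoc[symmetric])
    moreover have "1 \<in> ?C" using \<open>q \<notin> V\<close> \<gamma> by simp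
    ultimately obtain T where T: "T \<in> ?C" "\<And>t. t \<in> ?C \<Longrightarrow> T \<le> t"
      using compact_attains_inf[of ?C] by blast
    have "T \<noteq> 0" using T(1) \<gamma>(2) V(2) by auto
    then have T': "0 < T" "T \<le> 1" using T(1) by auto
    have sK: "\<gamma> s \<in> K" if "s \<in> {0..<T}" for s
      using that T(2)[of s] T' V(3) by force
    have "closed ({0..T} \<inter> \<gamma> -` K)"
      by (rule continuous_closed_preimage[OF continuous_on_subset[OF cont]]) (use T' \<open>closed K\<close> in auto)
    moreover have "{0..<T} \<subseteq> {0..T} \<inter> \<gamma> -` K" using sK by auto
    ultimately have "closure {0..<T} \<subseteq> {0..T} \<inter> \<gamma> -` K" by (rule closure_minimal[rotated])
    then have K': "\<gamma> s \<in> K" if "s \<in> {0..T}" for s using that T' by auto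
    have "pw_C1 A \<gamma> 0 T" using pw_C1_subinterval[OF \<gamma>(1)] T' by auto
    then have "k * norm (cmap c (\<gamma> T) - cmap c (\<gamma> 0)) \<le> len \<gamma> 0 T"
      by (rule chart_displacement_le_len[OF _ c(1)]) (use K K' k in auto)
    also have "\<dots> \<le> len \<gamma> 0 1" by (rule len_mono[OF \<gamma>(1)]) (use T' in auto)
    also have "\<dots> < k * r" by (rule \<gamma>)
    finally have "norm (cmap c (\<gamma> T) - ?z) < r" using k(1) \<gamma>(2) by simp
    then have "\<gamma> T \<in> V"
      using K[OF K'[of T]] T' by (intro VI) (auto simp: dist_norm norm_minus_commute)
    then show False using T(1) by auto
  qed
  then show ?thesis using that[of "k * r"] k(1) r(1) VU by auto
qed

text \<open>Definiteness is the one axiom that needs more than operations on curves: the complement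
  of \<open>q\<close> is open, so by \<open>riem_dist_refines\<close> every other point has positive
  distance to \<open>q\<close>.\<close>

lemma Metric_space_riem_dist: "Metric_space UNIV (riem_dist A g)"
proof
  fix p q r :: 'm
  show "riem_dist A g p q = 0 \<longleftrightarrow> p = q"
  proof
    assume d: "riem_dist A g p q = 0"
    show "p = q"
    proof (rule ccontr)
      assume "p \<noteq> q"
      then have "open (- {q})" "p \<in> - {q}" by auto
      then obtain e where "e > 0" "\<And>q'. riem_dist A g p q' < e \<Longrightarrow> q' \<in> - {q}"
        using riem_dist_refines by blast
      then show False using d by force
    qed
  qed (simp add: riem_dist_self)
qed (rule riem_dist_nonneg riem_dist_commute riem_dist_triangle)+

end

section \<open>The Ekeland variational principle and gradients\<close>

text \<open>Greedy descent: each term nearly minimizes \<open>f\<close> over the set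
  \<open>T\<close> of the previous one. Distances are paid for by decrease of \<open>f\<close>, so
  the sequence is Cauchy; its limit lies in every \<open>T (u n)\<close>, and near-minimality
  excludes a strictly better point.\<close>

lemma (in Metric_space) ekeland:
  assumes complete: mcomplete
    and bdd: "bdd_below (f ` M)"
    and lsc: "\<And>\<sigma> l e. limitin mtopology \<sigma> l sequentially \<Longrightarrow> 0 < e \<Longrightarrow>
      \<forall>\<^sub>F n in sequentially. f l - e < f (\<sigma> n)"
    and \<epsilon>: "0 < \<epsilon>" and x: "x \<in> M"
  obtains y where "y \<in> M" "f y + \<epsilon> * d x y \<le> f x" "\<And>z. z \<in> M \<Longrightarrow> f y \<le> f z + \<epsilon> * d y z"
proof -
  \<comment> \<open>The points to which \<open>u\<close> can move at the price
    \<open>\<epsilon>\<close> per unit of distance, paid by decrease of \<open>f\<close>. The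
    triangle inequality makes the relation transitive, and the later steps rest on this.\<close>
  define T where "T u = {z \<in> M. f z + \<epsilon> * d u z \<le> f u}" for u
  have T_self: "u \<in> T u" if "u \<in> M" for u using that by (simp add: T_def)
  have T_trans: "w \<in> T u" if "z \<in> T u" "w \<in> T z" "u \<in> M" for u z w
  proof -
    have "\<epsilon> * d u w \<le> \<epsilon> * d u z + \<epsilon> * d z w"
      using triangle[of u z w] that \<epsilon> by (auto simp: T_def simp flip: distrib_left)
    then show ?thesis using that by (auto simp: T_def)
  qed
  have bdd_T: "bdd_below (f ` T u)" for u
    by (rule bdd_below_mono[OF bdd]) (auto simp: T_def)
  \<comment> \<open>The infimum over \<open>T (u n)\<close> need not be attained, hence the slack
    \<open>(1/2)^n\<close>, of which only convergence to 0 matters.\<close>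
  have "\<exists>u. \<forall>n. (u n \<in> M \<and> (n = 0 \<longrightarrow> u n = x)) \<and>
      u (Suc n) \<in> T (u n) \<and> f (u (Suc n)) < Inf (f ` T (u n)) + (1/2)^n"
  proof (rule dependent_nat_choice)
    show "\<exists>u. u \<in> M \<and> ((0::nat) = 0 \<longrightarrow> u = x)" using x by blast
    fix u and n :: nat
    assume u: "u \<in> M \<and> (n = 0 \<longrightarrow> u = x)"
    have "\<exists>z\<in>f ` T u. z < Inf (f ` T u) + (1/2)^n"
      by (rule cInf_lessD) (use T_self u in auto)
    then show "\<exists>z. (z \<in> M \<and> (Suc n = 0 \<longrightarrow> z = x)) \<and> z \<in> T u \<and> f z < Inf (f ` T u) + (1/2)^n"
      by (auto simp: T_def)
  qed
  then obtain u where u: "\<And>n. u n \<in> M" "u 0 = x" "\<And>n. u (Suc n) \<in> T (u n)"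
    "\<And>n. f (u (Suc n)) < Inf (f ` T (u n)) + (1/2)^n"
    by blast
  have uT: "u (n + m) \<in> T (u n)" for n m
    by (induction m) (use T_self T_trans u in auto)
  have dec: "decseq (\<lambda>n. f (u n))"
  proof (rule decseq_SucI)
    fix n
    have "0 \<le> \<epsilon> * d (u n) (u (Suc n))" using \<epsilon> by simp
    then show "f (u (Suc n)) \<le> f (u n)" using u(3)[of n] by (simp add: T_def)
  qed
  obtain b where b: "\<And>z. z \<in> M \<Longrightarrow> b \<le> f z" using bdd unfolding bdd_below_def by blast
  obtain L where L: "(\<lambda>n. f (u n)) \<longlonglongrightarrow> L"
  proof (rule decseq_convergent[OF dec])
    show "\<forall>n. b \<le> f (u n)" using b u(1) by simp
  qed
  have "MCauchy u"
    unfolding MCauchy_def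
  proof (intro conjI allI impI)
    show "range u \<subseteq> M" using u(1) by blast
    fix e :: real assume e: "0 < e"
    obtain N where N: "\<And>m n. m \<ge> N \<Longrightarrow> n \<ge> N \<Longrightarrow> dist (f (u m)) (f (u n)) < \<epsilon> * e"
      using metric_CauchyD[OF LIMSEQ_imp_Cauchy[OF L], of "\<epsilon> * e"] e \<epsilon> by auto
    have *: "d (u n) (u m) < e" if "N \<le> n" "n \<le> m" for n m
    proof -
      have "\<epsilon> * d (u n) (u m) \<le> f (u n) - f (u m)"
        using uT[of n "m - n"] that by (simp add: T_def)
      also have "\<dots> < \<epsilon> * e" using N[of n m] that by (simp add: dist_real_def)
      finally show ?thesis using \<epsilon> by simp
    qed
    then show "\<exists>N. \<forall>n n'. N \<le> n \<longrightarrow> N \<le> n' \<longrightarrow> d (u n) (u n') < e"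
      using commute by (metis nle_le)
  qed
  then obtain y where y: "limitin mtopology u y sequentially"
    using complete unfolding mcomplete_def by blast
  have yM: "y \<in> M" using y by (simp add: limitin_metric)
  \<comment> \<open>Limit passage in \<open>u m \<in> T (u n)\<close>: lower semicontinuity costs
    \<open>e / 2\<close>, and replacing \<open>d (u n) y\<close> by \<open>d (u n) (u m)\<close>
    costs at most another \<open>e / 2\<close>.\<close>
  have yT: "y \<in> T (u n)" for n
  proof -
    have "f y + \<epsilon> * d (u n) y \<le> f (u n) + e" if e: "0 < e" for e
    proof -
      have "\<forall>\<^sub>F m in sequentially. f y - e / 2 < f (u m)" using lsc[OF y, of "e / 2"] e by simp
      moreover have "\<forall>\<^sub>F m in sequentially. u m \<in> M \<and> d (u m) y < e / (2 * \<epsilon>)"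
        using y e \<epsilon> unfolding limitin_metric by simp
      moreover have "\<forall>\<^sub>F m in sequentially. n \<le> m" by (rule eventually_ge_at_top)
      ultimately have "\<forall>\<^sub>F m in sequentially. f y - e / 2 < f (u m) \<and> d (u m) y < e / (2 * \<epsilon>) \<and> n \<le> m"
        by eventually_elim blast
      from eventually_happens'[OF sequentially_bot this]
      obtain m where m: "f y - e / 2 < f (u m)" "d (u m) y < e / (2 * \<epsilon>)" "n \<le> m"
        by blast
      have "f (u m) + \<epsilon> * d (u n) (u m) \<le> f (u n)"
        using uT[of n "m - n"] m(3) by (simp add: T_def)
      moreover have "\<epsilon> * d (u n) y \<le> \<epsilon> * d (u n) (u m) + \<epsilon> * d (u m) y"
        using triangle[of "u n" "u m" y] u(1) yM \<epsilon> by (simp flip: distrib_left)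
      moreover have "\<epsilon> * d (u m) y < e / 2" using m(2) \<epsilon> by (simp add: field_simps)
      ultimately show ?thesis using m(1) by linarith
    qed
    then show ?thesis using yM by (auto simp: T_def intro: field_le_epsilon)
  qed
  show ?thesis
  proof (rule that)
    show "y \<in> M" by (rule yM)
    show "f y + \<epsilon> * d x y \<le> f x" using yT[of 0] u(2) by (simp add: T_def)
    fix z assume z: "z \<in> M"
    show "f y \<le> f z + \<epsilon> * d y z"
    proof (rule ccontr)
      assume neg: "\<not> f y \<le> f z + \<epsilon> * d y z"
      \<comment> \<open>Such a \<open>z\<close> lies in \<open>T y\<close>, hence in every
        \<open>T (u n)\<close>, and \<open>f y\<close> exceeds the infimum of \<open>f\<close> there
        by at most \<open>(1/2)^n\<close>. So \<open>f y \<le> f z\<close>, against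
        \<open>neg\<close>.\<close>
      then have zT: "z \<in> T y" using z by (simp add: T_def)
      have "f y \<le> f z + (1/2)^n" for n
      proof -
        have "0 \<le> \<epsilon> * d (u (Suc n)) y" using \<epsilon> by simp
        then have "f y \<le> f (u (Suc n))" using yT[of "Suc n"] by (simp add: T_def)
        also have "\<dots> \<le> Inf (f ` T (u n)) + (1/2)^n" using u(4)[of n] by simp
        also have "Inf (f ` T (u n)) \<le> f z"
          using T_trans[OF yT[of n] zT u(1)] by (intro cInf_lower bdd_T imageI)
        finally show ?thesis by simp
      qed
      moreover have "(\<lambda>n. f z + (1/2)^n) \<longlonglongrightarrow> f z + 0"
        by (intro tendsto_add tendsto_const LIMSEQ_power_zero) simp
      ultimately have "f y \<le> f z + 0" by (intro LIMSEQ_le_const) auto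
      moreover have "0 \<le> \<epsilon> * d y z" using \<epsilon> by simp
      ultimately show False using neg by simp
    qed
  qed
qed

context riemannian_manifold
begin

section \<open>Continuity, differential and gradient of a C1 function\<close>

lemma C1_function_has_derivative:
  assumes "C1_function A f" "c \<in> A" "p \<in> cdom c"
  shows "((f \<circ> cinv c) has_derivative frechet_derivative (f \<circ> cinv c) (at (cmap c p))) (at (cmap c p))"
  using assms unfolding C1_function_def by (simp add: frechet_derivative_works)

lemma C1_function_isCont:
  assumes "C1_function A f"
  shows "isCont f p"
proof -
  obtain c where c: "c \<in> A" "p \<in> cdom c" by (rule chart_at)
  have "isCont (f \<circ> cinv c) (cmap c p)"
    using C1_function_has_derivative[OF assms c] by (rule has_derivative_continuous)
  moreover have "isCont (cmap c) p"
    using continuous_cmap[OF c(1)] open_cdom[OF c(1)] c(2) by (simp add: continuous_on_eq_continuous_at)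
  ultimately have "isCont (\<lambda>q. (f \<circ> cinv c) (cmap c q)) p" by (rule isCont_o2[rotated])
  moreover have "\<forall>\<^sub>F q in nhds p. (f \<circ> cinv c) (cmap c q) = f q"
    using eventually_nhds_in_open[OF open_cdom[OF c(1)] c(2)]
    by (rule eventually_mono) (simp add: cinv_cmap[OF c(1)])
  ultimately show ?thesis using isCont_cong[of "\<lambda>q. (f \<circ> cinv c) (cmap c q)" f p] by simp
qed

text \<open>By \<open>dtr_chain\<close> all charts around \<open>p\<close> give the same number, so
  the definite description in \<open>differential\<close> denotes it; uniqueness holds because
  \<open>c\<close> is one of these charts.\<close>

lemma differential_eq:
  assumes f: "C1_function A f" and c: "c \<in> A" "p \<in> cdom c" and v: "v \<in> tangent_space A p"
  shows "differential A f p v = frechet_derivative (f \<circ> cinv c) (at (cmap c p)) (v c)"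
  unfolding differential_def
proof (rule the_equality)
  show "\<forall>c'\<in>A. p \<in> cdom c' \<longrightarrow> frechet_derivative (f \<circ> cinv c) (at (cmap c p)) (v c) =
      frechet_derivative (f \<circ> cinv c') (at (cmap c' p)) (v c')"
  proof (intro ballI impI)
    fix c' assume c': "c' \<in> A" "p \<in> cdom c'"
    have "v c' = dtr c c' p (v c)" using v c c' unfolding tangent_space_def by blast
    moreover have "frechet_derivative (f \<circ> cinv c) (at (cmap c p)) =
        (\<lambda>a. frechet_derivative (f \<circ> cinv c') (at (cmap c' p)) (dtr c c' p a))"
      using frechet_derivative_at[OF dtr_chain[OF c(1) c'(1) c(2) c'(2)
          C1_function_has_derivative[OF f c']]] by simp
    ultimately show "frechet_derivative (f \<circ> cinv c) (at (cmap c p)) (v c) =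
      frechet_derivative (f \<circ> cinv c') (at (cmap c' p)) (v c')" by simp
  qed
qed (use c in blast)

text \<open>Existence is Riesz representation in one chart, carried back by
  \<open>coord_vec\<close>. Uniqueness, which the definite description also demands, is positive
  definiteness applied to the difference of two candidates.\<close>

lemma gradient_properties:
  assumes f: "C1_function A f"
  shows gradient_tangent: "gradient A g f p \<in> tangent_space A p"
    and metric_gradient: "\<And>w. w \<in> tangent_space A p \<Longrightarrow> g p (gradient A g f p) w = differential A f p w"
proof -
  obtain c where c: "c \<in> A" "p \<in> cdom c" by (rule chart_at)
  let ?\<phi> = "frechet_derivative (f \<circ> cinv c) (at (cmap c p))"
  interpret inner_form "chart_metric c (cmap c p)" by (rule inner_form_chart_metric) (use c in auto)
  have "linear ?\<phi>" using C1_function_has_derivative[OF f c] by (rule has_derivative_linear)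
  moreover obtain B :: "'e set" where "finite B" "span B = UNIV" using finite_dimensional by blast
  ultimately obtain v where v: "\<And>w. chart_metric c (cmap c p) v w = ?\<phi> w" using riesz by blast
  have chart_metric: "g p u w = chart_metric c (cmap c p) (u c) (w c)"
    if "u \<in> tangent_space A p" "w \<in> tangent_space A p" for u w
    using tangent_eq_coord_vec[OF c that(1)] tangent_eq_coord_vec[OF c that(2)]
    by (simp add: chart_metric_def cinv_cmap[OF c])
  let ?P = "\<lambda>v. v \<in> tangent_space A p \<and> (\<forall>w\<in>tangent_space A p. g p v w = differential A f p w)"
  have "?P (coord_vec A c p v)"
    using coord_vec_tangent[OF c] by (auto simp: chart_metric coord_vec_self[OF c] v differential_eq[OF f c])
  moreover have "u = coord_vec A c p v" if u: "?P u" for u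
  proof -
    have "chart_metric c (cmap c p) (u c) a = ?\<phi> a" for a
      using u coord_vec_tangent[OF c, of a] chart_metric[of u "coord_vec A c p a"]
      by (simp add: coord_vec_self[OF c] differential_eq[OF f c])
    then have "chart_metric c (cmap c p) (u c - v) (u c - v) = 0" by (simp add: diff_left v)
    then have "u c = v" using pos[of "u c - v"] by fastforce
    then show ?thesis using tangent_eq_coord_vec[OF c, of u] u by simp
  qed
  ultimately have "?P (gradient A g f p)" unfolding gradient_def by (rule theI)
  then show "gradient A g f p \<in> tangent_space A p"
    "\<And>w. w \<in> tangent_space A p \<Longrightarrow> g p (gradient A g f p) w = differential A f p w"
    by blast+
qed

text \<open>The strict inequality leaves room: the speed of the segment is continuous, so on a short
  initial piece it is at most \<open>N\<close>, and the length up to time \<open>t\<close> is at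
  most \<open>N * t\<close>.\<close>

lemma riem_dist_segment:
  assumes c: "c \<in> A" "p \<in> cdom c" and n: "sqrt (chart_metric c (cmap c p) a a) < N"
  obtains h where "0 < h" "\<And>t. t \<in> {0..h} \<Longrightarrow> cmap c p + t *\<^sub>R a \<in> cmap c ` cdom c"
    "\<And>t. 0 < t \<Longrightarrow> t \<le> h \<Longrightarrow> riem_dist A g p (cinv c (cmap c p + t *\<^sub>R a)) \<le> N * t"
proof -
  let ?z = "cmap c p"
  obtain r where r: "r > 0" "cball ?z r \<subseteq> cmap c ` (cdom c \<inter> UNIV)"
    using ball_in_chart[OF c open_UNIV UNIV_I] by blast
  \<comment> \<open>Keeps the segment inside the chart ball; the summand 1 avoids division by 0 when
    \<open>a = 0\<close>.\<close>
  define h1 where "h1 = r / (norm a + 1)"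
  have h1: "h1 > 0" using r(1) by (simp add: h1_def add_nonneg_pos)
  have im: "?z + t *\<^sub>R a \<in> cmap c ` cdom c" if "t \<in> {0..h1}" for t
  proof -
    have "t * norm a \<le> h1 * (norm a + 1)" using that h1 by (intro mult_mono) auto
    also have "\<dots> = r" by (simp add: h1_def add_nonneg_eq_0_iff)
    finally have "?z + t *\<^sub>R a \<in> cball ?z r" using that by (simp add: dist_norm)
    then show ?thesis using r(2) by auto
  qed
  have cont: "continuous_on {0..h1} (\<lambda>t. sqrt (chart_metric c (?z + t *\<^sub>R a) a a))"
    by (intro continuous_on_real_sqrt continuous_on_chart_metric[OF c(1)] continuous_intros im)
  have "0 \<in> {0..h1}" "0 < N - sqrt (chart_metric c ?z a a)" using h1 n by auto
  with cont[unfolded continuous_on_iff] obtain d where "d > 0" "\<forall>t\<in>{0..h1}. dist t 0 < d \<longrightarrow>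
      dist (sqrt (chart_metric c (?z + t *\<^sub>R a) a a)) (sqrt (chart_metric c (?z + 0 *\<^sub>R a) a a)) < N - sqrt (chart_metric c ?z a a)"
    by blast
  then have d: "d > 0" "\<And>t. t \<in> {0..h1} \<Longrightarrow> dist t 0 < d \<Longrightarrow>
      dist (sqrt (chart_metric c (?z + t *\<^sub>R a) a a)) (sqrt (chart_metric c ?z a a)) < N - sqrt (chart_metric c ?z a a)"
    by auto
  define h where "h = min h1 (d / 2)"
  have h: "0 < h" "h \<le> h1" "h < d" using h1 d(1) by (auto simp: h_def)
  have le: "sqrt (chart_metric c (?z + t *\<^sub>R a) a a) \<le> N" if "t \<in> {0..h}" for t
    using d(2)[of t] that h by (auto simp: dist_real_def)
  show ?thesis
  proof (rule that[of h])
    fix t :: real assume t: "0 < t" "t \<le> h"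
    let ?\<gamma> = "\<lambda>t. cinv c (?z + t *\<^sub>R a)"
    have im': "?z + s *\<^sub>R a \<in> cmap c ` cdom c" if "s \<in> {0..t}" for s
      using im[of s] that t h by auto
    have pw: "pw_C1 A ?\<gamma> 0 t"
      by (rule pw_C1.single[OF t(1) segment_C1[OF c(1) t(1) im']])
    have "len ?\<gamma> 0 t = integral {0..t} (\<lambda>s. sqrt (chart_metric c (?z + s *\<^sub>R a) a a))"
      unfolding len_def
    proof (rule integral_spike[of "{0, t}"])
      fix s assume "s \<in> {0..t} - {0, t}"
      then have "s \<in> {0<..<t}" by auto
      from segment_speed[OF c(1) t(1) im' this]
      show "sqrt (chart_metric c (?z + s *\<^sub>R a) a a) = speed ?\<gamma> s" by simp
    qed simp
    also have "\<dots> \<le> integral {0..t} (\<lambda>s. N)"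
    proof (rule integral_le)
      show "(\<lambda>s. sqrt (chart_metric c (?z + s *\<^sub>R a) a a)) integrable_on {0..t}"
        by (rule integrable_continuous_interval[OF continuous_on_subset[OF cont]]) (use t h in auto)
    qed (use le t in auto)
    also have "\<dots> = N * t" using t by simp
    finally have "len ?\<gamma> 0 t \<le> N * t" .
    then show "riem_dist A g p (?\<gamma> t) \<le> N * t"
      using riem_dist_le_len[OF pw] by (simp add: cinv_cmap[OF c])
  qed (use h im in auto)
qed

text \<open>Along the chart segment from \<open>p\<close> in direction \<open>w\<close>,
  \<open>min\<close> bounds the decrease of \<open>f\<close> by \<open>\<epsilon>\<close> times the
  distance, which to first order is at most \<open>tnorm g p w * t\<close>. Dividing by
  \<open>t > 0\<close> and letting \<open>t\<close> tend to 0 from the right gives the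
  claim.\<close>

lemma differential_lower_bound:
  assumes f: "C1_function A f" and \<epsilon>: "0 < \<epsilon>"
    and min: "\<And>z. f p \<le> f z + \<epsilon> * riem_dist A g p z"
    and w: "w \<in> tangent_space A p"
  shows "- \<epsilon> * tnorm g p w \<le> differential A f p w"
proof -
  obtain c where c: "c \<in> A" "p \<in> cdom c" by (rule chart_at)
  let ?z = "cmap c p" let ?a = "w c"
  let ?\<phi> = "frechet_derivative (f \<circ> cinv c) (at (cmap c p))"
  let ?q = "\<lambda>t. cinv c (?z + t *\<^sub>R ?a)"
  have tn: "tnorm g p w = sqrt (chart_metric c ?z ?a ?a)" by (rule tnorm_chart[OF c w])
  have D: "((f \<circ> cinv c) has_derivative ?\<phi>) (at ?z)" by (rule C1_function_has_derivative[OF f c])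
  have "((\<lambda>t::real. ?z + t *\<^sub>R ?a) has_derivative (\<lambda>t. t *\<^sub>R ?a)) (at 0)"
    by (auto intro!: derivative_eq_intros)
  from has_derivative_compose[OF this, of "f \<circ> cinv c" ?\<phi>] D
  have "((\<lambda>t. f (?q t)) has_derivative (\<lambda>t. ?\<phi> (t *\<^sub>R ?a))) (at 0)" by simp
  moreover have "?\<phi> (t *\<^sub>R ?a) = ?\<phi> ?a * t" for t
    using linear_scale[OF has_derivative_linear[OF D], of t ?a] by simp
  ultimately have "((\<lambda>t. f (?q t)) has_field_derivative ?\<phi> ?a) (at 0)"
    by (simp add: has_field_derivative_def)
  then have lim: "((\<lambda>t. (f (?q t) - f p) / t) \<longlongrightarrow> ?\<phi> ?a) (at_right 0)"
    using cinv_cmap[OF c] unfolding DERIV_def by (auto intro: filterlim_at_within_not_equal tendsto_mono[OF at_le])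
  have "- \<epsilon> * tnorm g p w \<le> ?\<phi> ?a + e" if e: "0 < e" for e
  proof -
    \<comment> \<open>The slack \<open>e / \<epsilon>\<close> provides the strict inequality for
      \<open>riem_dist_segment\<close> and becomes exactly \<open>e\<close> after multiplication by
      \<open>\<epsilon>\<close>.\<close>
    let ?N = "tnorm g p w + e / \<epsilon>"
    have "sqrt (chart_metric c ?z ?a ?a) < ?N" using e \<epsilon> by (simp add: tn)
    then obtain h where h: "0 < h"
      "\<And>t. 0 < t \<Longrightarrow> t \<le> h \<Longrightarrow> riem_dist A g p (?q t) \<le> ?N * t"
      using riem_dist_segment[OF c] by metis
    have "- \<epsilon> * ?N \<le> (f (?q t) - f p) / t" if t: "0 < t" "t < h" for t
    proof -
      have "\<epsilon> * riem_dist A g p (?q t) \<le> \<epsilon> * (?N * t)" using h(2)[of t] t \<epsilon> by simp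
      then have "- \<epsilon> * ?N * t \<le> f (?q t) - f p" using min[of "?q t"] by simp
      then show ?thesis using t by (simp add: pos_le_divide_eq)
    qed
    then have "\<forall>\<^sub>F t in at_right 0. - \<epsilon> * ?N \<le> (f (?q t) - f p) / t"
      using h(1) by (auto simp: eventually_at_right_field)
    then have "- \<epsilon> * ?N \<le> ?\<phi> ?a"
      by (rule tendsto_lowerbound[OF lim]) simp
    then show ?thesis using \<epsilon> by (simp add: distrib_left)
  qed
  then have "- \<epsilon> * tnorm g p w \<le> ?\<phi> ?a" by (rule field_le_epsilon)
  then show ?thesis using differential_eq[OF f c w] by simp
qed

text \<open>On minus the gradient the differential is minus the squared norm, so the lower bound
  says that the squared norm is at most \<open>\<epsilon>\<close> times the norm.\<close>

lemma gradient_bound: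
  assumes f: "C1_function A f" and \<epsilon>: "0 < \<epsilon>"
    and min: "\<And>z. f p \<le> f z + \<epsilon> * riem_dist A g p z"
  shows "tnorm g p (gradient A g f p) \<le> \<epsilon>"
proof -
  let ?v = "gradient A g f p"
  \<comment> \<open>Minus the gradient as a scalar multiple, the form in which
    \<open>tnorm_scale\<close> and the scaling clause of \<open>inner_product_on\<close>
    apply.\<close>
  let ?w = "\<lambda>c. (-1) *\<^sub>R ?v c"
  obtain c where c: "c \<in> A" "p \<in> cdom c" by (rule chart_at)
  have v: "?v \<in> tangent_space A p" by (rule gradient_tangent[OF f])
  have "?w = coord_vec A c p ((-1) *\<^sub>R ?v c)"
    using coord_vec_scale[OF c, of "-1" "?v c"] tangent_eq_coord_vec[OF c v] by metis
  then have w: "?w \<in> tangent_space A p" using coord_vec_tangent[OF c] by metis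
  have ip: "inner_product_on (tangent_space A p) (g p)"
    using metric unfolding riemannian_metric_def by blast
  have "g p ?v ?w = g p ?w ?v" using ip v w unfolding inner_product_on_def by blast
  also have "\<dots> = - 1 * g p ?v ?v" using ip v unfolding inner_product_on_def by blast
  finally have "differential A f p ?w = - g p ?v ?v" using metric_gradient[OF f w] by simp
  moreover have "tnorm g p ?w = tnorm g p ?v" using tnorm_scale[OF v, of "-1"] by simp
  ultimately have le: "g p ?v ?v \<le> \<epsilon> * tnorm g p ?v"
    using differential_lower_bound[OF f \<epsilon> min w] by simp
  have nn: "0 \<le> tnorm g p ?v" by (rule tnorm_nonneg[OF v])
  then have "g p ?v ?v = tnorm g p ?v * tnorm g p ?v" by (simp add: tnorm_def)
  then show ?thesis using le nn \<epsilon> by (cases "tnorm g p ?v = 0") auto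
qed

text \<open>This is the semicontinuity hypothesis of \<open>ekeland\<close>. \<open>f\<close> is
  continuous for the manifold topology, and \<open>riem_dist_refines\<close> finds a distance ball
  inside each neighbourhood of \<open>l\<close>.\<close>

lemma C1_function_limitin:
  assumes f: "C1_function A f"
    and lim: "limitin (Metric_space.mtopology UNIV (riem_dist A g)) \<sigma> l sequentially" and e: "0 < e"
  shows "\<forall>\<^sub>F n in sequentially. f l - e < f (\<sigma> n)"
proof -
  interpret Metric_space UNIV "riem_dist A g" by (rule Metric_space_riem_dist)
  have "\<forall>\<^sub>F q in nhds l. f l - e < f q"
    using C1_function_isCont[OF f, of l] e unfolding isCont_def tendsto_at_iff_tendsto_nhds
    by (intro order_tendstoD(1)) auto
  then obtain U where U: "open U" "l \<in> U" "\<And>q. q \<in> U \<Longrightarrow> f l - e < f q"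
    unfolding eventually_nhds by blast
  obtain \<delta> where \<delta>: "\<delta> > 0" "\<And>q. riem_dist A g l q < \<delta> \<Longrightarrow> q \<in> U"
    using riem_dist_refines[OF U(1,2)] by blast
  have "\<forall>\<^sub>F n in sequentially. riem_dist A g (\<sigma> n) l < \<delta>"
    using lim \<delta>(1) unfolding limitin_metric by auto
  then show ?thesis by (rule eventually_mono) (use U \<delta> commute in metis)
qed

end

theorem theorem1p2:
  fixes A :: "('m::{t2_space,second_countable_topology}, 'e::real_inner) chart set"
    and g :: "('m, 'e) metric_field"
    and f :: "'m \<Rightarrow> real"
    and x :: "nat \<Rightarrow> 'm"
  assumes "complete_riemannian_manifold A g"
    and "C1_function A f"
    and "bdd_below (range f)"
    and "(\<lambda>n. f (x n)) \<longlonglongrightarrow> (INF p. f p)"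
  shows "\<exists>y :: nat \<Rightarrow> 'm.
           (\<lambda>n. riem_dist A g (x n) (y n)) \<longlonglongrightarrow> 0 \<and>
           (\<lambda>n. f (y n)) \<longlonglongrightarrow> (INF p. f p) \<and>
           (\<lambda>n. tnorm g (y n) (gradient A g f (y n))) \<longlonglongrightarrow> 0"
proof -
  interpret riemannian_manifold A g
    using assms(1) unfolding complete_riemannian_manifold_def by unfold_locales auto
  interpret M: Metric_space UNIV "riem_dist A g" by (rule Metric_space_riem_dist)
  have complete: M.mcomplete using assms(1) unfolding complete_riemannian_manifold_def by blast
  define I where "I = (INF p. f p)"
  have I: "I \<le> f p" for p unfolding I_def by (rule cINF_lower[OF assms(3)]) simp
  \<comment> \<open>The second summand keeps \<open>\<epsilon> n\<close> positive even when
    \<open>f (x n)\<close> equals the infimum, and it vanishes in the limit.\<close>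
  define \<epsilon> where "\<epsilon> n = sqrt (f (x n) - I) + 1 / real (Suc n)" for n
  have \<epsilon>: "0 < \<epsilon> n" for n using I by (auto simp: \<epsilon>_def intro: add_nonneg_pos)
  have \<epsilon>0: "\<epsilon> \<longlonglongrightarrow> 0"
  proof -
    have "(\<lambda>n. sqrt (f (x n) - I) + 1 / real (Suc n)) \<longlonglongrightarrow> sqrt (I - I) + 0"
      using assms(4) unfolding I_def[symmetric]
      by (intro tendsto_add tendsto_real_sqrt tendsto_diff tendsto_const LIMSEQ_Suc[OF lim_1_over_n])
    then show ?thesis by (simp add: \<epsilon>_def[abs_def])
  qed
  have "\<exists>y. f y + \<epsilon> n * riem_dist A g (x n) y \<le> f (x n) \<and> (\<forall>z. f y \<le> f z + \<epsilon> n * riem_dist A g y z)" for n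
    by (rule M.ekeland[OF complete assms(3) C1_function_limitin[OF assms(2)] \<epsilon>[of n] UNIV_I, of "x n"]) auto
  then obtain y where y: "\<And>n. f (y n) + \<epsilon> n * riem_dist A g (x n) (y n) \<le> f (x n)"
    "\<And>n z. f (y n) \<le> f z + \<epsilon> n * riem_dist A g (y n) z"
    by metis
  have "riem_dist A g (x n) (y n) \<le> \<epsilon> n" for n
  proof -
    have "\<epsilon> n * riem_dist A g (x n) (y n) \<le> f (x n) - I" using y(1)[of n] I[of "y n"] by simp
    also have "\<dots> = sqrt (f (x n) - I) * sqrt (f (x n) - I)" using I[of "x n"] by simp
    also have "\<dots> \<le> \<epsilon> n * \<epsilon> n" using I[of "x n"] by (intro mult_mono) (auto simp: \<epsilon>_def)
    finally show ?thesis using \<epsilon>[of n] by simp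
  qed
  then have "(\<lambda>n. riem_dist A g (x n) (y n)) \<longlonglongrightarrow> 0"
    by (intro tendsto_sandwich[OF _ _ tendsto_const \<epsilon>0]) (auto intro: always_eventually)
  moreover have "(\<lambda>n. f (y n)) \<longlonglongrightarrow> (INF p. f p)"
  proof (rule tendsto_sandwich[OF _ _ tendsto_const assms(4)])
    show "\<forall>\<^sub>F n in sequentially. (INF p. f p) \<le> f (y n)" using I by (simp add: I_def)
    have "f (y n) \<le> f (x n)" for n
    proof -
      have "0 \<le> \<epsilon> n * riem_dist A g (x n) (y n)" using \<epsilon>[of n] by simp
      then show ?thesis using y(1)[of n] by simp
    qed
    then show "\<forall>\<^sub>F n in sequentially. f (y n) \<le> f (x n)" by simp
  qed
  moreover have "(\<lambda>n. tnorm g (y n) (gradient A g f (y n))) \<longlonglongrightarrow> 0"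
    by (rule tendsto_sandwich[OF _ _ tendsto_const \<epsilon>0])
      (use gradient_bound[OF assms(2) \<epsilon> y(2)] tnorm_nonneg[OF gradient_tangent[OF assms(2)]] in auto)
  ultimately show ?thesis by blast
qed

end
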